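(* Let $M$ be a closed manifold and let $(M,g(t))$, $t\in[0,T)$, be a solution to the Ricci flow $\frac{\partial g_{ij}}{\partial t}=-2R_{ij}$. Let $f$ be a positive solution on $M\times[0,T)$, with $f<1$, of the heat equation $$\frac{\partial f}{\partial t}=\triangle_{g(t)} f,$$ and set $u=-\ln f$ and $$H=|\nabla u|^2-\frac ut.$$ Then $H\le 0$ on $M$ for all $t\in(0,T)$. Hence on $M\times (0,T)$, $$|\nabla f|^2\le -\frac{f^2\ln f}{t}.$$
   Context: $R_{ij}$ denotes the Ricci tensor of $g(t)$; $\triangle_{g(t)}$ is the Laplace–Beltrami operator (trace of the Hessian), and $\nabla$ and $|\cdot|$ are taken with respect to $g(t)$. "Closed" means compact without boundary. Solutions are understood to be smooth. *)

theory Defs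
  imports "HOL-Analysis.Analysis"
begin

section \<open>Smooth functions on subsets of Euclidean space\<close>

(* Derivatives are taken within S, so the notion makes sense on half-open sets such as
   {0..<T} \<times> V with V open, where the derivative within S is still unique; there it means
   smoothness up to the boundary t = 0.  On open S it is ordinary C^k. *)
primrec Ck_on :: "nat \<Rightarrow> 'a::euclidean_space set \<Rightarrow> ('a \<Rightarrow> 'b::real_normed_vector) \<Rightarrow> bool" where
  "Ck_on 0 S h \<longleftrightarrow> continuous_on S h"
| "Ck_on (Suc k) S h \<longleftrightarrow>
     h differentiable_on S \<and> (\<forall>v. Ck_on k S (\<lambda>x. frechet_derivative h (at x within S) v))"

definition smooth_on :: "'a::euclidean_space set \<Rightarrow> ('a \<Rightarrow> 'b::real_normed_vector) \<Rightarrow> bool" where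
  "smooth_on S h \<longleftrightarrow> (\<forall>k. Ck_on k S h)"


section \<open>Smooth manifolds\<close>

type_synonym ('m, 'n) chart = "'m set \<times> ('m \<Rightarrow> real^'n)"

abbreviation chart_dom :: "('m, 'n::finite) chart \<Rightarrow> 'm set" where
  "chart_dom c \<equiv> fst c"

abbreviation chart_map :: "('m, 'n::finite) chart \<Rightarrow> 'm \<Rightarrow> real^'n" where
  "chart_map c \<equiv> snd c"

definition chart_image :: "('m, 'n::finite) chart \<Rightarrow> (real^'n) set" where
  "chart_image c = chart_map c ` chart_dom c"

definition chart_inv :: "('m, 'n::finite) chart \<Rightarrow> real^'n \<Rightarrow> 'm" where
  "chart_inv c = inv_into (chart_dom c) (chart_map c)"

definition is_chart :: "'m topology \<Rightarrow> ('m, 'n::finite) chart \<Rightarrow> bool" where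
  "is_chart M c \<longleftrightarrow>
     openin M (chart_dom c) \<and> open (chart_image c) \<and>
     homeomorphic_map (subtopology M (chart_dom c)) (top_of_set (chart_image c)) (chart_map c)"

definition smooth_atlas :: "'m topology \<Rightarrow> ('m, 'n::finite) chart set \<Rightarrow> bool" where
  "smooth_atlas M A \<longleftrightarrow>
     (\<forall>c\<in>A. is_chart M c) \<and>
     (\<Union>c\<in>A. chart_dom c) = topspace M \<and>
     (\<forall>c\<in>A. \<forall>d\<in>A.
        smooth_on (chart_map c ` (chart_dom c \<inter> chart_dom d)) (chart_map d \<circ> chart_inv c))"

definition smooth_manifold :: "'m topology \<Rightarrow> ('m, 'n::finite) chart set \<Rightarrow> bool" where
  "smooth_manifold M A \<longleftrightarrow> Hausdorff_space M \<and> second_countable M \<and> smooth_atlas M A"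

(* There is no boundary, since charts map onto open subsets of R^n. *)
definition closed_manifold :: "'m topology \<Rightarrow> ('m, 'n::finite) chart set \<Rightarrow> bool" where
  "closed_manifold M A \<longleftrightarrow> smooth_manifold M A \<and> compact_space M"


section \<open>Riemannian metrics in local coordinates\<close>

(* The i-th coordinate derivative, in the chart c, of a function on the manifold. *)
definition pderiv_chart ::
    "('m, 'n::finite) chart \<Rightarrow> 'n \<Rightarrow> ('m \<Rightarrow> real) \<Rightarrow> 'm \<Rightarrow> real" where
  "pderiv_chart c i h p =
     frechet_derivative (h \<circ> chart_inv c) (at (chart_map c p)) (axis i 1)"

(* For a metric \<gamma>, the matrix entry \<gamma> c p $ i $ j is the component \<gamma>_ij at the point p in the
   coordinates of the chart c. *)
type_synonym ('m, 'n) metric_field = "('m, 'n) chart \<Rightarrow> 'm \<Rightarrow> real^'n^'n"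

definition transition_jacobian ::
    "('m, 'n::finite) chart \<Rightarrow> ('m, 'n) chart \<Rightarrow> 'm \<Rightarrow> real^'n^'n" where
  "transition_jacobian c d p = jacobian (chart_map d \<circ> chart_inv c) (at (chart_map c p))"

definition riemannian_metric ::
    "('m, 'n::finite) chart set \<Rightarrow> ('m, 'n) metric_field \<Rightarrow> bool" where
  "riemannian_metric A \<gamma> \<longleftrightarrow>
     (\<forall>c\<in>A. smooth_on (chart_image c) (\<lambda>y. \<gamma> c (chart_inv c y))) \<and>
     (\<forall>c\<in>A. \<forall>p\<in>chart_dom c.
        transpose (\<gamma> c p) = \<gamma> c p \<and> (\<forall>v. v \<noteq> 0 \<longrightarrow> v \<bullet> (\<gamma> c p *v v) > 0)) \<and>
     (\<forall>c\<in>A. \<forall>d\<in>A. \<forall>p\<in>chart_dom c \<inter> chart_dom d.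
        \<gamma> c p =
          transpose (transition_jacobian c d p) ** \<gamma> d p ** transition_jacobian c d p)"

definition metric_inv :: "('m, 'n::finite) metric_field \<Rightarrow> ('m, 'n) chart \<Rightarrow> 'm \<Rightarrow> real^'n^'n" where
  "metric_inv \<gamma> c p = matrix_inv (\<gamma> c p)"

(* christoffel \<gamma> c k i j is Gamma^k_ij of the Levi-Civita connection. *)
definition christoffel ::
    "('m, 'n::finite) metric_field \<Rightarrow> ('m, 'n) chart \<Rightarrow> 'n \<Rightarrow> 'n \<Rightarrow> 'n \<Rightarrow> 'm \<Rightarrow> real" where
  "christoffel \<gamma> c k i j p =
     (1/2) * (\<Sum>l\<in>UNIV. metric_inv \<gamma> c p $ k $ l *
        (pderiv_chart c i (\<lambda>q. \<gamma> c q $ j $ l) p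
         + pderiv_chart c j (\<lambda>q. \<gamma> c q $ i $ l) p
         - pderiv_chart c l (\<lambda>q. \<gamma> c q $ i $ j) p))"

(* riemann_curv \<gamma> c l i j k is the coefficient R^l_ijk in R(d_i,d_j) d_k = R^l_ijk d_l, with
   R(X,Y)Z = nabla_X nabla_Y Z - nabla_Y nabla_X Z - nabla_[X,Y] Z. *)
definition riemann_curv ::
    "('m, 'n::finite) metric_field \<Rightarrow> ('m, 'n) chart \<Rightarrow> 'n \<Rightarrow> 'n \<Rightarrow> 'n \<Rightarrow> 'n \<Rightarrow> 'm \<Rightarrow> real" where
  "riemann_curv \<gamma> c l i j k p =
     pderiv_chart c i (christoffel \<gamma> c l j k) p
     - pderiv_chart c j (christoffel \<gamma> c l i k) p
     + (\<Sum>m\<in>UNIV. christoffel \<gamma> c l i m p * christoffel \<gamma> c m j k p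
                  - christoffel \<gamma> c l j m p * christoffel \<gamma> c m i k p)"

(* Ric(Y,Z) is the trace of X |-> R(X,Y)Z; positive on round spheres. *)
definition ricci ::
    "('m, 'n::finite) metric_field \<Rightarrow> ('m, 'n) chart \<Rightarrow> 'n \<Rightarrow> 'n \<Rightarrow> 'm \<Rightarrow> real" where
  "ricci \<gamma> c j k p = (\<Sum>i\<in>UNIV. riemann_curv \<gamma> c i i j k p)"

definition hessian ::
    "('m, 'n::finite) metric_field \<Rightarrow> ('m, 'n) chart \<Rightarrow> ('m \<Rightarrow> real) \<Rightarrow> 'n \<Rightarrow> 'n \<Rightarrow> 'm \<Rightarrow> real" where
  "hessian \<gamma> c h i j p =
     pderiv_chart c i (pderiv_chart c j h) p
     - (\<Sum>k\<in>UNIV. christoffel \<gamma> c k i j p * pderiv_chart c k h p)"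

definition laplacian ::
    "('m, 'n::finite) metric_field \<Rightarrow> ('m, 'n) chart \<Rightarrow> ('m \<Rightarrow> real) \<Rightarrow> 'm \<Rightarrow> real" where
  "laplacian \<gamma> c h p =
     (\<Sum>i\<in>UNIV. \<Sum>j\<in>UNIV. metric_inv \<gamma> c p $ i $ j * hessian \<gamma> c h i j p)"

definition gradient ::
    "('m, 'n::finite) metric_field \<Rightarrow> ('m, 'n) chart \<Rightarrow> ('m \<Rightarrow> real) \<Rightarrow> 'm \<Rightarrow> real^'n" where
  "gradient \<gamma> c h p = metric_inv \<gamma> c p *v (\<chi> j. pderiv_chart c j h p)"

definition metric_norm ::
    "('m, 'n::finite) metric_field \<Rightarrow> ('m, 'n) chart \<Rightarrow> 'm \<Rightarrow> real^'n \<Rightarrow> real" where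
  "metric_norm \<gamma> c p v = sqrt (v \<bullet> (\<gamma> c p *v v))"


section \<open>Ricci flow and the heat equation\<close>

(* [0,T), where T may be infinite. *)
definition time_interval :: "ereal \<Rightarrow> real set" where
  "time_interval T = {t. 0 \<le> t \<and> ereal t < T}"

(* Time derivatives are taken within [0,T), i.e. one-sided at t = 0. *)
definition ricci_flow ::
    "('m, 'n::finite) chart set \<Rightarrow> ereal \<Rightarrow> (real \<Rightarrow> ('m, 'n) metric_field) \<Rightarrow> bool" where
  "ricci_flow A T g \<longleftrightarrow>
     (\<forall>t\<in>time_interval T. riemannian_metric A (g t)) \<and>
     (\<forall>c\<in>A. smooth_on (time_interval T \<times> chart_image c) (\<lambda>(t, y). g t c (chart_inv c y))) \<and>
     (\<forall>t\<in>time_interval T. \<forall>c\<in>A. \<forall>p\<in>chart_dom c. \<forall>i j.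
        ((\<lambda>s. g s c p $ i $ j) has_real_derivative - 2 * ricci (g t) c i j p)
          (at t within time_interval T))"

definition heat_solution ::
    "('m, 'n::finite) chart set \<Rightarrow> ereal \<Rightarrow> (real \<Rightarrow> ('m, 'n) metric_field)
      \<Rightarrow> (real \<Rightarrow> 'm \<Rightarrow> real) \<Rightarrow> bool" where
  "heat_solution A T g f \<longleftrightarrow>
     (\<forall>c\<in>A. smooth_on (time_interval T \<times> chart_image c) (\<lambda>(t, y). f t (chart_inv c y))) \<and>
     (\<forall>t\<in>time_interval T. \<forall>c\<in>A. \<forall>p\<in>chart_dom c.
        ((\<lambda>s. f s p) has_real_derivative laplacian (g t) c (f t) p)
          (at t within time_interval T))"

end

theory Submission
  imports Defs
begin

text \<open>
  The estimate is a maximum principle for $W = t\,|\nabla u|^2 - u$, where $u = -\ln f$.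
  The heat equation for $f$ becomes $\partial_t u = \Delta u - |\nabla u|^2$.  Under Ricci flow the
  term $2\,\mathrm{Ric}(\nabla u,\nabla u)$ from $\partial_t g^{-1}$ cancels the curvature
  term of the Bochner formula, so that
  $(\partial_t - \Delta)|\nabla u|^2 =
    -2\,|\nabla^2 u|^2 - 2\langle\nabla u, \nabla|\nabla u|^2\rangle$.
  At a point where $\nabla W = 0$, that is $t\,\nabla|\nabla u|^2 = \nabla u$, this gives
  $(\partial_t - \Delta) W = -2t\,|\nabla^2 u|^2 \le 0$.

  If $W$ were positive somewhere at a time $t_0 > 0$, then $W - \varepsilon t$ would be positive
  there too for small $\varepsilon > 0$.  Its maximum over the compact $[0,t_0]\times M$ would be
  attained at a time $t_1 > 0$, because $W = -u < 0$ at time $0$.  There $\nabla W = 0$,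
  $\Delta W \le 0$ and $\partial_t W \ge \varepsilon$, which is absurd.  So $W \le 0$, which is the
  first inequality, and the second one is the same statement because $\nabla f = -f\,\nabla u$.

  All differential geometry takes place on an open subset of space-time $\mathbb{R}\times
  \mathbb{R}^n$, where the metric, its inverse and $u$ are smooth functions and $\partial_t$,
  $\partial_1,\dots,\partial_n$ are commuting derivations.  \<open>bochner\<close> and
  \<open>dt_nonpos_at_spatial_max\<close> are the computations above.  Globally one needs that $|\nabla u|^2$
  does not depend on the chart (\<open>grad_norm_sq_chart_independent\<close>), that $W$ is continuous up to
  $t = 0$ (\<open>continuous_W_in_chart\<close>), and compactness (\<open>W_nonpos\<close>).
\<close>

section \<open>Smooth functions and directional derivatives\<close>

text \<open>The derivative in a fixed direction, as an operator on functions: on the smooth functions on an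
  open set these operators are commuting derivations, and the curvature identities below are
  computations with such derivations.\<close>
definition dirderiv :: "'a::real_normed_vector \<Rightarrow> ('a \<Rightarrow> real) \<Rightarrow> 'a \<Rightarrow> real" where
  "dirderiv v h z = frechet_derivative h (at z) v"

lemma dirderiv_eqI: "(h has_derivative h') (at z) \<Longrightarrow> dirderiv v h z = h' v"
  unfolding dirderiv_def using frechet_derivative_at by metis

lemma has_derivative_dirderiv: "h differentiable (at z) \<Longrightarrow> (h has_derivative (\<lambda>v. dirderiv v h z)) (at z)"
  unfolding dirderiv_def by (simp add: frechet_derivative_works)

lemma frechet_derivative_within_cong:
  assumes "\<And>x. x \<in> S \<Longrightarrow> f x = g x" "x \<in> S"
  shows "frechet_derivative f (at x within S) = frechet_derivative g (at x within S)"
proof -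
  have "(f has_derivative d) (at x within S) \<longleftrightarrow> (g has_derivative d) (at x within S)" for d
    using has_derivative_transform[of x S f g d] has_derivative_transform[of x S g f d] assms by auto
  then show ?thesis unfolding frechet_derivative_def by simp
qed

lemma Ck_on_cong:
  "(\<And>x. x \<in> S \<Longrightarrow> f x = g x) \<Longrightarrow> Ck_on k S f \<longleftrightarrow> Ck_on k S g"
proof (induction k arbitrary: f g)
  case 0
  then show ?case by (auto intro: continuous_on_cong)
next
  case (Suc k)
  have "f differentiable_on S \<longleftrightarrow> g differentiable_on S"
    using Suc.prems unfolding differentiable_on_def differentiable_def
    by (metis (no_types, opaque_lifting) has_derivative_transform)
  moreover have "Ck_on k S (\<lambda>x. frechet_derivative f (at x within S) v) \<longleftrightarrow>
      Ck_on k S (\<lambda>x. frechet_derivative g (at x within S) v)" for v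
    by (rule Suc.IH) (use frechet_derivative_within_cong[of S f g] Suc.prems in auto)
  ultimately show ?case by simp
qed

text \<open>On an open set the derivative within the set is the ordinary one, which turns the recursion of
  \<^const>\<open>Ck_on\<close> into one on directional derivatives.  The closure properties below are inductions
  along it.\<close>
lemma Ck_on_Suc_open:
  assumes "open S"
  shows "Ck_on (Suc k) S h \<longleftrightarrow> (\<forall>z\<in>S. h differentiable (at z)) \<and> (\<forall>v. Ck_on k S (dirderiv v h))"
proof -
  have "Ck_on k S (\<lambda>x. frechet_derivative h (at x within S) v) \<longleftrightarrow> Ck_on k S (dirderiv v h)" for v
    by (rule Ck_on_cong) (simp add: dirderiv_def at_within_open[OF _ assms])
  then show ?thesis
    by (simp add: differentiable_on_def at_within_open[OF _ assms])
qed

lemma Ck_on_open_subset: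
  "Ck_on k S h \<Longrightarrow> open U \<Longrightarrow> U \<subseteq> S \<Longrightarrow> Ck_on k U h"
proof (induction k arbitrary: h)
  case 0
  then show ?case using continuous_on_subset by auto
next
  case (Suc k)
  have "Ck_on k U (\<lambda>x. frechet_derivative h (at x within U) v)" for v
  proof -
    have "Ck_on k U (\<lambda>x. frechet_derivative h (at x within S) v)"
      using Suc by auto
    moreover have "at x within S = at x within U" if "x \<in> U" for x
      using that Suc.prems by (metis at_within_open at_within_open_subset)
    ultimately show ?thesis
      using Ck_on_cong[of U "\<lambda>x. frechet_derivative h (at x within S) v"] by simp
  qed
  then show ?case using Suc.prems differentiable_on_subset by auto
qed

lemma Ck_on_Suc_imp: "Ck_on (Suc k) S h \<Longrightarrow> Ck_on k S h"
proof (induction k arbitrary: h)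
  case 0
  then show ?case by (simp add: differentiable_imp_continuous_on)
next
  case (Suc k)
  then show ?case by (metis Ck_on.simps(2))
qed

lemma Ck_on_const: "open S \<Longrightarrow> Ck_on k S (\<lambda>_. c::real)"
proof (induction k arbitrary: c)
  case (Suc k)
  have "dirderiv v (\<lambda>_. c) = (\<lambda>_. 0)" for v :: 'a
    by (auto simp: dirderiv_def)
  then show ?case using Suc by (simp add: Ck_on_Suc_open del: Ck_on.simps)
qed simp

lemma Ck_on_add:
  "open S \<Longrightarrow> Ck_on k S f \<Longrightarrow> Ck_on k S g \<Longrightarrow> Ck_on k S (\<lambda>x. f x + g x :: real)"
proof (induction k arbitrary: f g)
  case 0
  then show ?case by (auto intro: continuous_intros)
next
  case (Suc k)
  note d = Suc.prems(2,3)[unfolded Ck_on_Suc_open[OF \<open>open S\<close>]]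
  have "dirderiv v (\<lambda>x. f x + g x) z = dirderiv v f z + dirderiv v g z" if "z \<in> S" for v z
    by (rule dirderiv_eqI) (use d that in \<open>auto intro!: has_derivative_add has_derivative_dirderiv\<close>)
  then have "Ck_on k S (dirderiv v (\<lambda>x. f x + g x)) \<longleftrightarrow> Ck_on k S (\<lambda>z. dirderiv v f z + dirderiv v g z)" for v
    by (intro Ck_on_cong) auto
  then show ?case using Suc d by (auto simp: Ck_on_Suc_open simp del: Ck_on.simps)
qed

lemma Ck_on_mult:
  "open S \<Longrightarrow> Ck_on k S f \<Longrightarrow> Ck_on k S g \<Longrightarrow> Ck_on k S (\<lambda>x. f x * g x :: real)"
proof (induction k arbitrary: f g)
  case 0
  then show ?case by (auto intro: continuous_intros)
next
  case (Suc k)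
  note d = Suc.prems(2,3)[unfolded Ck_on_Suc_open[OF \<open>open S\<close>]]
  have "dirderiv v (\<lambda>x. f x * g x) z = f z * dirderiv v g z + dirderiv v f z * g z" if "z \<in> S" for v z
    by (rule dirderiv_eqI) (use d that in \<open>auto intro!: has_derivative_mult has_derivative_dirderiv\<close>)
  then have "Ck_on k S (dirderiv v (\<lambda>x. f x * g x)) \<longleftrightarrow>
      Ck_on k S (\<lambda>z. f z * dirderiv v g z + dirderiv v f z * g z)" for v
    by (intro Ck_on_cong) auto
  moreover have "Ck_on k S (\<lambda>z. f z * dirderiv v g z + dirderiv v f z * g z)" for v
    using Suc d Ck_on_Suc_imp by (intro Ck_on_add Suc.IH) blast+
  ultimately show ?case using d Suc.prems(1) by (auto simp: Ck_on_Suc_open simp del: Ck_on.simps)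
qed

lemma Ck_on_inverse:
  "open S \<Longrightarrow> Ck_on k S f \<Longrightarrow> (\<And>x. x \<in> S \<Longrightarrow> f x \<noteq> 0) \<Longrightarrow> Ck_on k S (\<lambda>x. inverse (f x) :: real)"
proof (induction k arbitrary: f)
  case 0
  then show ?case by (auto intro: continuous_intros)
next
  case (Suc k)
  note d = Suc.prems(2)[unfolded Ck_on_Suc_open[OF \<open>open S\<close>]]
  have "dirderiv v (\<lambda>x. inverse (f x)) z = (-1) * (inverse (f z) * dirderiv v f z * inverse (f z))" if "z \<in> S" for v z
    using dirderiv_eqI[OF Deriv.has_derivative_inverse[OF _ has_derivative_dirderiv], of f z v] d that Suc.prems by simp
  then have "Ck_on k S (dirderiv v (\<lambda>x. inverse (f x))) \<longleftrightarrow>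
      Ck_on k S (\<lambda>z. (-1) * (inverse (f z) * dirderiv v f z * inverse (f z)))" for v
    by (intro Ck_on_cong) auto
  moreover have "Ck_on k S (\<lambda>z. (-1) * (inverse (f z) * dirderiv v f z * inverse (f z)))" for v
    using Suc d Ck_on_Suc_imp by (intro Ck_on_mult Ck_on_const Suc.IH) blast+
  moreover have "\<forall>z\<in>S. (\<lambda>x. inverse (f x)) differentiable (at z)"
    using d Suc.prems(3) by (auto intro: differentiable_inverse)
  ultimately show ?case using Suc.prems(1) by (auto simp: Ck_on_Suc_open simp del: Ck_on.simps)
qed

lemma smooth_on_subset: "smooth_on S h \<Longrightarrow> open U \<Longrightarrow> U \<subseteq> S \<Longrightarrow> smooth_on U h"
  unfolding smooth_on_def using Ck_on_open_subset by blast

lemma smooth_on_cong: "(\<And>x. x \<in> S \<Longrightarrow> f x = g x) \<Longrightarrow> smooth_on S f \<longleftrightarrow> smooth_on S g"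
  unfolding smooth_on_def using Ck_on_cong by blast

lemma smooth_on_open_iff:
  assumes "open S"
  shows "smooth_on S h \<longleftrightarrow> (\<forall>z\<in>S. h differentiable (at z)) \<and> (\<forall>v. smooth_on S (dirderiv v h))"
    (is "?l \<longleftrightarrow> ?r")
proof
  assume ?l
  then show ?r using Ck_on_Suc_open[OF assms] unfolding smooth_on_def by blast
next
  assume r: ?r
  have "Ck_on k S h" for k
  proof (cases k)
    case 0
    have "continuous_on S h"
      using r by (meson continuous_at_imp_continuous_on differentiable_imp_continuous_within)
    then show ?thesis using 0 by simp
  next
    case (Suc m)
    then show ?thesis using r Ck_on_Suc_open[OF assms] unfolding smooth_on_def by blast
  qed
  then show ?l by (simp add: smooth_on_def)
qed

lemma smooth_on_differentiable:
  fixes h :: "'a::euclidean_space \<Rightarrow> real"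
  shows "open S \<Longrightarrow> smooth_on S h \<Longrightarrow> z \<in> S \<Longrightarrow> h differentiable (at z)"
  using smooth_on_open_iff by blast

lemma smooth_on_dirderiv: "open S \<Longrightarrow> smooth_on S h \<Longrightarrow> smooth_on S (dirderiv v h)"
  using smooth_on_open_iff by blast

lemma smooth_on_continuous: "smooth_on S h \<Longrightarrow> continuous_on S h"
  unfolding smooth_on_def by (metis Ck_on.simps(1))

lemma smooth_on_const: "open S \<Longrightarrow> smooth_on S (\<lambda>_. c::real)"
  by (simp add: smooth_on_def Ck_on_const)

lemma smooth_on_add: "open S \<Longrightarrow> smooth_on S f \<Longrightarrow> smooth_on S g \<Longrightarrow> smooth_on S (\<lambda>x. f x + g x :: real)"
  by (simp add: smooth_on_def Ck_on_add)

lemma smooth_on_mult: "open S \<Longrightarrow> smooth_on S f \<Longrightarrow> smooth_on S g \<Longrightarrow> smooth_on S (\<lambda>x. f x * g x :: real)"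
  by (simp add: smooth_on_def Ck_on_mult)

lemma smooth_on_minus: "open S \<Longrightarrow> smooth_on S f \<Longrightarrow> smooth_on S (\<lambda>x. - f x :: real)"
  using smooth_on_mult[OF _ smooth_on_const[of S "-1"], of f] by simp

lemma smooth_on_diff: "open S \<Longrightarrow> smooth_on S f \<Longrightarrow> smooth_on S g \<Longrightarrow> smooth_on S (\<lambda>x. f x - g x :: real)"
  using smooth_on_add[OF _ _ smooth_on_minus[of S g], of f] by simp

lemma smooth_on_divide:
  "open S \<Longrightarrow> smooth_on S f \<Longrightarrow> smooth_on S g \<Longrightarrow> (\<And>x. x \<in> S \<Longrightarrow> g x \<noteq> 0) \<Longrightarrow>
   smooth_on S (\<lambda>x. f x / g x :: real)"
  unfolding divide_inverse by (rule smooth_on_mult) (auto simp: smooth_on_def Ck_on_inverse)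

lemma smooth_on_sum:
  "open S \<Longrightarrow> (\<And>i. i \<in> I \<Longrightarrow> smooth_on S (f i)) \<Longrightarrow> smooth_on S (\<lambda>x. \<Sum>i\<in>I. f i x :: real)"
  by (induction I rule: infinite_finite_induct) (auto intro: smooth_on_const smooth_on_add)

lemma smooth_on_prod:
  "open S \<Longrightarrow> (\<And>i. i \<in> I \<Longrightarrow> smooth_on S (f i)) \<Longrightarrow> smooth_on S (\<lambda>x. \<Prod>i\<in>I. f i x :: real)"
  by (induction I rule: infinite_finite_induct) (auto intro: smooth_on_const smooth_on_mult)

lemma smooth_on_bounded_linear:
  fixes l :: "'a::euclidean_space \<Rightarrow> real"
  assumes "open S" "bounded_linear l"
  shows "smooth_on S l"
proof -
  have "(l has_derivative l) (at z)" for z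
    using assms(2) by (rule bounded_linear_imp_has_derivative)
  moreover from this have "dirderiv v l = (\<lambda>_. l v)" for v
    using dirderiv_eqI by blast
  ultimately show ?thesis
    using assms by (subst smooth_on_open_iff) (auto simp: smooth_on_const differentiable_def)
qed

lemma
  fixes f :: "'a::euclidean_space \<Rightarrow> real"
  assumes "open S" "smooth_on S f" "\<And>x. x \<in> S \<Longrightarrow> f x > 0"
  shows smooth_on_ln: "smooth_on S (\<lambda>x. ln (f x))"
    and dirderiv_ln: "\<And>v z. z \<in> S \<Longrightarrow> dirderiv v (\<lambda>x. ln (f x)) z = dirderiv v f z / f z"
proof -
  have D: "((\<lambda>x. ln (f x)) has_derivative (\<lambda>v. dirderiv v f z / f z)) (at z)" if "z \<in> S" for z
  proof -
    have "(f has_derivative (\<lambda>v. dirderiv v f z)) (at z)"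
      using assms that by (intro has_derivative_dirderiv smooth_on_differentiable)
    from has_derivative_ln[OF _ this] show ?thesis
      using assms(3)[OF that] by (simp add: divide_inverse)
  qed
  then show *: "\<And>v z. z \<in> S \<Longrightarrow> dirderiv v (\<lambda>x. ln (f x)) z = dirderiv v f z / f z"
    by (rule dirderiv_eqI)
  have "smooth_on S (dirderiv v (\<lambda>x. ln (f x)))" for v
  proof (subst smooth_on_cong)
    show "dirderiv v (\<lambda>x. ln (f x)) z = dirderiv v f z / f z" if "z \<in> S" for z
      using * that .
    show "smooth_on S (\<lambda>z. dirderiv v f z / f z)"
      using assms by (intro smooth_on_divide smooth_on_dirderiv) force+
  qed
  then show "smooth_on S (\<lambda>x. ln (f x))"
    using D assms(1) by (subst smooth_on_open_iff) (auto simp: differentiable_def)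
qed

lemma dirderiv_cong:
  assumes "open S" "z \<in> S" "\<And>x. x \<in> S \<Longrightarrow> f x = g x"
  shows "dirderiv v f z = dirderiv v g z"
  using frechet_derivative_within_cong[OF assms(3,2)]
  unfolding dirderiv_def at_within_open[OF assms(2,1)] by simp

lemma dirderiv_const: "dirderiv v (\<lambda>x. c) z = 0"
  by (simp add: dirderiv_def)

context
  fixes S :: "'a::euclidean_space set" and z :: 'a
  assumes S: "open S" and z: "z \<in> S"
begin

private lemma has_dirderiv: "smooth_on S f \<Longrightarrow> (f has_derivative (\<lambda>v. dirderiv v f z)) (at z)"
  by (rule has_derivative_dirderiv[OF smooth_on_differentiable[OF S _ z]])

lemma dirderiv_add:
  assumes "smooth_on S f" "smooth_on S g"
  shows "dirderiv v (\<lambda>x. f x + g x) z = dirderiv v f z + dirderiv v g z"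
  by (rule dirderiv_eqI[OF has_derivative_add[OF assms[THEN has_dirderiv]]])

lemma dirderiv_diff:
  assumes "smooth_on S f" "smooth_on S g"
  shows "dirderiv v (\<lambda>x. f x - g x) z = dirderiv v f z - dirderiv v g z"
  by (rule dirderiv_eqI[OF has_derivative_diff[OF assms[THEN has_dirderiv]]])

lemma dirderiv_minus:
  assumes "smooth_on S f"
  shows "dirderiv v (\<lambda>x. - f x) z = - dirderiv v f z"
  by (rule dirderiv_eqI[OF has_derivative_minus[OF assms[THEN has_dirderiv]]])

lemma dirderiv_mult:
  assumes "smooth_on S f" "smooth_on S g"
  shows "dirderiv v (\<lambda>x. f x * g x) z = dirderiv v f z * g z + f z * dirderiv v g z"
  using dirderiv_eqI[OF has_derivative_mult[OF assms[THEN has_dirderiv]]] by simp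

lemma dirderiv_sum:
  assumes "\<And>i. i \<in> I \<Longrightarrow> smooth_on S (f i)"
  shows "dirderiv v (\<lambda>x. \<Sum>i\<in>I. f i x) z = (\<Sum>i\<in>I. dirderiv v (f i) z)"
  by (rule dirderiv_eqI[OF has_derivative_sum[OF assms[THEN has_dirderiv]]])

end

lemma line_derivative:
  assumes "open S" "smooth_on S h" "z + s *\<^sub>R v \<in> S"
  shows "((\<lambda>s. h (z + s *\<^sub>R v)) has_real_derivative dirderiv v h (z + s *\<^sub>R v)) (at s)"
proof -
  have "((\<lambda>s. s *\<^sub>R v) has_derivative (\<lambda>r. r *\<^sub>R v)) (at s)"
    by (intro bounded_linear_imp_has_derivative bounded_linear_scaleR_left)
  from has_derivative_add[OF has_derivative_const[of z] this]
  have "((\<lambda>s. z + s *\<^sub>R v) has_derivative (\<lambda>r. r *\<^sub>R v)) (at s)" by simp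
  from has_derivative_compose[OF this has_derivative_dirderiv[OF smooth_on_differentiable[OF assms]]]
  have "((\<lambda>s. h (z + s *\<^sub>R v)) has_derivative (\<lambda>r. dirderiv (r *\<^sub>R v) h (z + s *\<^sub>R v))) (at s)" .
  moreover have "dirderiv (r *\<^sub>R v) h (z + s *\<^sub>R v) = dirderiv v h (z + s *\<^sub>R v) * r" for r
    using linear_cmul[OF has_derivative_linear[OF has_derivative_dirderiv[OF smooth_on_differentiable[OF assms]]]]
    by simp
  ultimately show ?thesis by (simp add: has_field_derivative_def)
qed

text \<open>By the mean value theorem, applied once in each direction.  The left-hand side is symmetric in
  \<open>v\<close> and \<open>w\<close>, so shrinking the parallelogram gives the symmetry of second derivatives.\<close>
lemma double_difference_mvt:
  assumes "open S" "smooth_on S h" "0 < s"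
    and sub: "\<And>a b. 0 \<le> a \<Longrightarrow> a \<le> s \<Longrightarrow> 0 \<le> b \<Longrightarrow> b \<le> s \<Longrightarrow> z + a *\<^sub>R v + b *\<^sub>R w \<in> S"
  shows "\<exists>a b. 0 < a \<and> a < s \<and> 0 < b \<and> b < s \<and>
    h (z + s *\<^sub>R v + s *\<^sub>R w) - h (z + s *\<^sub>R v) - h (z + s *\<^sub>R w) + h z
      = s * s * dirderiv w (dirderiv v h) (z + a *\<^sub>R v + b *\<^sub>R w)"
proof -
  define q where "q r = h ((z + s *\<^sub>R w) + r *\<^sub>R v) - h (z + r *\<^sub>R v)" for r
  have "\<exists>a. 0 < a \<and> a < s \<and>
     q s - q 0 = (s - 0) * (dirderiv v h ((z + s *\<^sub>R w) + a *\<^sub>R v) - dirderiv v h (z + a *\<^sub>R v))"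
  proof (rule MVT2[OF \<open>0 < s\<close>])
    fix r assume r: "0 \<le> r" "r \<le> s"
    show "(q has_real_derivative dirderiv v h ((z + s *\<^sub>R w) + r *\<^sub>R v) - dirderiv v h (z + r *\<^sub>R v)) (at r)"
      unfolding q_def
      using sub[OF r, of s] sub[OF r, of 0] assms(1-3)
      by (intro DERIV_diff line_derivative) (auto simp: algebra_simps)
  qed
  then obtain a where a: "0 < a" "a < s" and
    1: "q s - q 0 = s * (dirderiv v h ((z + a *\<^sub>R v) + s *\<^sub>R w) - dirderiv v h ((z + a *\<^sub>R v) + 0 *\<^sub>R w))"
    by (auto simp: algebra_simps)
  have "\<exists>b. 0 < b \<and> b < s \<and>
     dirderiv v h ((z + a *\<^sub>R v) + s *\<^sub>R w) - dirderiv v h ((z + a *\<^sub>R v) + 0 *\<^sub>R w)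
       = (s - 0) * dirderiv w (dirderiv v h) ((z + a *\<^sub>R v) + b *\<^sub>R w)"
    using a assms
    by (intro MVT2[OF \<open>0 < s\<close>] line_derivative[of S "dirderiv v h"] smooth_on_dirderiv) auto
  then obtain b where b: "0 < b" "b < s" and
    2: "dirderiv v h ((z + a *\<^sub>R v) + s *\<^sub>R w) - dirderiv v h ((z + a *\<^sub>R v) + 0 *\<^sub>R w)
       = s * dirderiv w (dirderiv v h) ((z + a *\<^sub>R v) + b *\<^sub>R w)" by auto
  have "q s - q 0 = s * s * dirderiv w (dirderiv v h) (z + a *\<^sub>R v + b *\<^sub>R w)"
    using 1 2 by simp
  moreover have "q s - q 0 = h (z + s *\<^sub>R v + s *\<^sub>R w) - h (z + s *\<^sub>R v) - h (z + s *\<^sub>R w) + h z"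
    by (simp add: q_def algebra_simps)
  ultimately show ?thesis using a b by metis
qed

lemma dirderiv_commute:
  assumes "open S" "smooth_on S h" "z \<in> S"
  shows "dirderiv v (dirderiv w h) z = dirderiv w (dirderiv v h) z"
proof (rule ccontr)
  assume ne: "dirderiv v (dirderiv w h) z \<noteq> dirderiv w (dirderiv v h) z"
  define e where "e = \<bar>dirderiv v (dirderiv w h) z - dirderiv w (dirderiv v h) z\<bar> / 2"
  have e: "e > 0" using ne by (simp add: e_def)
  have c: "isCont (dirderiv v (dirderiv w h)) z" "isCont (dirderiv w (dirderiv v h)) z"
    using assms smooth_on_continuous smooth_on_dirderiv continuous_on_eq_continuous_at by metis+
  obtain d1 where d1: "d1 > 0" "\<And>y. dist y z < d1 \<Longrightarrow> dist (dirderiv v (dirderiv w h) y) (dirderiv v (dirderiv w h) z) < e"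
    using c(1) e unfolding continuous_at_eps_delta by blast
  obtain d2 where d2: "d2 > 0" "\<And>y. dist y z < d2 \<Longrightarrow> dist (dirderiv w (dirderiv v h) y) (dirderiv w (dirderiv v h) z) < e"
    using c(2) e unfolding continuous_at_eps_delta by blast
  obtain d3 where d3: "d3 > 0" "ball z d3 \<subseteq> S"
    using assms openE by blast
  define d where "d = min d1 (min d2 d3)"
  have d: "d > 0" using d1 d2 d3 by (simp add: d_def)
  (* s is so small that the parallelogram spanned by s v and s w stays within d of z. *)
  define s where "s = d / (2 * (norm v + norm w + 1))"
  have s: "s > 0" unfolding s_def using d by (intro divide_pos_pos) (auto simp: add_nonneg_pos)
  have near: "dist (z + a *\<^sub>R v + b *\<^sub>R w) z < d" if "0 \<le> a" "a \<le> s" "0 \<le> b" "b \<le> s" for a b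
  proof -
    have "dist (z + a *\<^sub>R v + b *\<^sub>R w) z \<le> a * norm v + b * norm w"
      using norm_triangle_ineq[of "a *\<^sub>R v" "b *\<^sub>R w"] that by (simp add: dist_norm)
    also have "\<dots> \<le> s * norm v + s * norm w"
      using that by (intro add_mono mult_right_mono) auto
    also have "\<dots> \<le> s * (norm v + norm w + 1)"
      using s by (simp add: algebra_simps)
    also have "\<dots> = d / 2"
      by (simp add: s_def add_nonneg_eq_0_iff field_simps)
    finally show ?thesis using d by simp
  qed
  have inS: "z + a *\<^sub>R v + b *\<^sub>R w \<in> S" if "0 \<le> a" "a \<le> s" "0 \<le> b" "b \<le> s" for a b
    using near[OF that] d3(2) by (auto simp: d_def dist_commute subset_iff)
  have inS': "z + a *\<^sub>R w + b *\<^sub>R v \<in> S" if "0 \<le> a" "a \<le> s" "0 \<le> b" "b \<le> s" for a b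
    using inS[of b a] that by (simp add: algebra_simps)
  obtain a b where ab: "0 < a" "a < s" "0 < b" "b < s" and
    1: "h (z + s *\<^sub>R v + s *\<^sub>R w) - h (z + s *\<^sub>R v) - h (z + s *\<^sub>R w) + h z
      = s * s * dirderiv w (dirderiv v h) (z + a *\<^sub>R v + b *\<^sub>R w)"
    using double_difference_mvt[OF assms(1,2) s, of z v w] inS by blast
  obtain a' b' where ab': "0 < a'" "a' < s" "0 < b'" "b' < s" and
    2: "h (z + s *\<^sub>R w + s *\<^sub>R v) - h (z + s *\<^sub>R w) - h (z + s *\<^sub>R v) + h z
      = s * s * dirderiv v (dirderiv w h) (z + a' *\<^sub>R w + b' *\<^sub>R v)"
    using double_difference_mvt[OF assms(1,2) s, of z w v] inS' by blast
  have "s * s * dirderiv w (dirderiv v h) (z + a *\<^sub>R v + b *\<^sub>R w) = s * s * dirderiv v (dirderiv w h) (z + b' *\<^sub>R v + a' *\<^sub>R w)"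
    using 1 2 by (simp add: algebra_simps)
  then have eq: "dirderiv w (dirderiv v h) (z + a *\<^sub>R v + b *\<^sub>R w) = dirderiv v (dirderiv w h) (z + b' *\<^sub>R v + a' *\<^sub>R w)"
    using s by simp
  have "dist (dirderiv w (dirderiv v h) (z + a *\<^sub>R v + b *\<^sub>R w)) (dirderiv w (dirderiv v h) z) < e"
    using near[of a b] ab by (intro d2) (auto simp: d_def)
  moreover have "dist (dirderiv v (dirderiv w h) (z + b' *\<^sub>R v + a' *\<^sub>R w)) (dirderiv v (dirderiv w h) z) < e"
    using near[of b' a'] ab' by (intro d1) (auto simp: d_def)
  ultimately show False
    unfolding eq e_def dist_real_def by (smt (verit) field_sum_of_halves)
qed

text \<open>The maximum is only required on the line through \<open>z\<close>, so that this applies to maxima in space at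
  a fixed time.\<close>
lemma dirderiv_local_max:
  assumes "open S" "smooth_on S h" "z \<in> S" and max: "\<And>s::real. z + s *\<^sub>R v \<in> S \<Longrightarrow> h (z + s *\<^sub>R v) \<le> h z"
  shows "dirderiv v h z = 0" and "dirderiv v (dirderiv v h) z \<le> 0"
proof -
  have "open ((\<lambda>s::real. z + s *\<^sub>R v) -` S)"
    by (intro open_vimage assms continuous_intros)
  moreover have "0 \<in> (\<lambda>s::real. z + s *\<^sub>R v) -` S" using assms by simp
  ultimately obtain d where "d > 0" "ball 0 d \<subseteq> (\<lambda>s::real. z + s *\<^sub>R v) -` S"
    by (meson openE)
  then have d: "d > 0" "\<And>s. \<bar>s\<bar> < d \<Longrightarrow> z + s *\<^sub>R v \<in> S"
    by (auto simp: subset_iff dist_real_def)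
  have D: "((\<lambda>s. k (z + s *\<^sub>R v)) has_real_derivative dirderiv v k (z + s *\<^sub>R v)) (at s)"
    if "\<bar>s\<bar> < d" "smooth_on S k" for s k
    using line_derivative[OF assms(1)] d that by auto
  show 0: "dirderiv v h z = 0"
    using DERIV_local_max[OF D[OF _ assms(2), of 0] d(1)] d max by auto
  show "dirderiv v (dirderiv v h) z \<le> 0"
  proof (rule ccontr)
    assume "\<not> dirderiv v (dirderiv v h) z \<le> 0"
    then have "0 < dirderiv v (dirderiv v h) (z + 0 *\<^sub>R v)" by simp
    from DERIV_pos_inc_right[OF D[OF _ smooth_on_dirderiv[OF assms(1,2)], of 0] this] d(1)
    obtain e where e: "e > 0" "\<And>s. 0 < s \<Longrightarrow> s < e \<Longrightarrow> dirderiv v h (z + s *\<^sub>R v) > 0"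
      using 0 by (metis abs_zero add_0 add.right_neutral scaleR_zero_left)
    define r where "r = min d e / 2"
    have r: "0 < r" "r < d" "r < e" using d e by (auto simp: r_def)
    have "\<exists>\<xi>. 0 < \<xi> \<and> \<xi> < r \<and> h (z + r *\<^sub>R v) - h (z + 0 *\<^sub>R v) = (r - 0) * dirderiv v h (z + \<xi> *\<^sub>R v)"
      using r by (intro MVT2 D assms) auto
    then obtain \<xi> where "0 < \<xi>" "\<xi> < r" "h (z + r *\<^sub>R v) - h z = r * dirderiv v h (z + \<xi> *\<^sub>R v)" by auto
    moreover have "dirderiv v h (z + \<xi> *\<^sub>R v) > 0" using e calculation r by simp
    ultimately have "h (z + r *\<^sub>R v) > h z" using r by (smt (verit) mult_pos_pos)
    then show False using max[of r] d(2)[of r] r by auto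
  qed
qed


section \<open>Finite sums and quadratic forms\<close>

lemma sum3_rotate: "(\<Sum>a\<in>UNIV. \<Sum>b\<in>UNIV. \<Sum>c\<in>UNIV. f a b c) = (\<Sum>c\<in>UNIV. \<Sum>a\<in>UNIV. \<Sum>b\<in>UNIV. f a b c)"
  for f :: "'a::finite \<Rightarrow> 'b::finite \<Rightarrow> 'c::finite \<Rightarrow> real"
proof -
  have "(\<Sum>a\<in>UNIV. \<Sum>b\<in>UNIV. \<Sum>c\<in>UNIV. f a b c) = (\<Sum>a\<in>UNIV. \<Sum>c\<in>UNIV. \<Sum>b\<in>UNIV. f a b c)"
    by (intro sum.cong refl sum.swap)
  also have "\<dots> = (\<Sum>c\<in>UNIV. \<Sum>a\<in>UNIV. \<Sum>b\<in>UNIV. f a b c)"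
    by (rule sum.swap)
  finally show ?thesis .
qed

lemma sum3_reverse: "(\<Sum>a\<in>UNIV. \<Sum>b\<in>UNIV. \<Sum>c\<in>UNIV. f a b c) = (\<Sum>c\<in>UNIV. \<Sum>b\<in>UNIV. \<Sum>a\<in>UNIV. f a b c)"
  for f :: "'a::finite \<Rightarrow> 'b::finite \<Rightarrow> 'c::finite \<Rightarrow> real"
  unfolding sum3_rotate[of f] by (intro sum.cong refl sum.swap)

text \<open>The pointwise algebra of the Bochner formula.  Here \<open>x\<close> stands for the components of a vector field,
  \<open>d k i\<close> for $\partial_k x^i$, \<open>e l i m\<close> for $\partial_l\partial_i x^m$, \<open>\<gamma> k i j\<close> for
  $\Gamma^k_{ij}$, \<open>\<gamma>' p k i j\<close> for $\partial_p\Gamma^k_{ij}$ and \<open>s i k\<close> for $\nabla_k x^i$.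
  The identity reads $\nabla_l (x^i \nabla_i x^l) =
  x^i\,\partial_i(\nabla_l x^l) + R_{im} x^i x^m + \nabla_i x^l\,\nabla_l x^i$: commuting the two covariant
  derivatives of a vector field and contracting produces the Ricci tensor directly.
  Apart from the last term, both sides are expanded into
  the seven contractions named in the proof.\<close>
lemma bochner_contraction:
  fixes x :: "'n::finite \<Rightarrow> real" and d s :: "'n \<Rightarrow> 'n \<Rightarrow> real"
    and \<gamma> e :: "'n \<Rightarrow> 'n \<Rightarrow> 'n \<Rightarrow> real" and \<gamma>' :: "'n \<Rightarrow> 'n \<Rightarrow> 'n \<Rightarrow> 'n \<Rightarrow> real"
  assumes s: "\<And>i k. d k i = s i k - (\<Sum>m\<in>UNIV. \<gamma> i k m * x m)"
    and \<gamma>: "\<And>k i j. \<gamma> k i j = \<gamma> k j i" and e: "\<And>l i m. e l i m = e i l m"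
  shows "(\<Sum>l\<in>UNIV. \<Sum>i\<in>UNIV. (e l i l + (\<Sum>m\<in>UNIV. \<gamma>' l l i m * x m + \<gamma> l i m * d l m)) * x i + s l i * d l i)
      + (\<Sum>l\<in>UNIV. \<Sum>m\<in>UNIV. \<gamma> l l m * (\<Sum>i\<in>UNIV. s m i * x i))
    = (\<Sum>i\<in>UNIV. x i * (\<Sum>l\<in>UNIV. e i l l + (\<Sum>m\<in>UNIV. \<gamma>' i l l m * x m + \<gamma> l l m * d i m)))
      + (\<Sum>i\<in>UNIV. \<Sum>m\<in>UNIV. (\<Sum>l\<in>UNIV. \<gamma>' l l i m - \<gamma>' i l l m
            + (\<Sum>p\<in>UNIV. \<gamma> l l p * \<gamma> p i m - \<gamma> l i p * \<gamma> p l m)) * x i * x m)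
      + (\<Sum>i\<in>UNIV. \<Sum>l\<in>UNIV. s l i * s i l)" (is "?L1 + ?L2 = ?R1 + ?R2 + ?R3")
proof -
  define E where "E = (\<Sum>i\<in>UNIV. \<Sum>l\<in>UNIV. x i * e i l l)"
  define P where "P = (\<Sum>i\<in>UNIV. \<Sum>l\<in>UNIV. \<Sum>m\<in>UNIV. x i * \<gamma>' l l i m * x m)"
  define Q where "Q = (\<Sum>i\<in>UNIV. \<Sum>l\<in>UNIV. \<Sum>m\<in>UNIV. x i * \<gamma>' i l l m * x m)"
  define U where "U = (\<Sum>i\<in>UNIV. \<Sum>l\<in>UNIV. \<Sum>m\<in>UNIV. x i * \<gamma> l i m * s m l)"
  define V where "V = (\<Sum>i\<in>UNIV. \<Sum>l\<in>UNIV. \<Sum>m\<in>UNIV. \<Sum>p\<in>UNIV. x i * \<gamma> l i m * \<gamma> m l p * x p)"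
  define Y where "Y = (\<Sum>i\<in>UNIV. \<Sum>l\<in>UNIV. \<Sum>m\<in>UNIV. x i * \<gamma> l l m * s m i)"
  define R where "R = (\<Sum>i\<in>UNIV. \<Sum>l\<in>UNIV. \<Sum>m\<in>UNIV. \<Sum>p\<in>UNIV. x i * \<gamma> l l m * \<gamma> m i p * x p)"
  have 1: "(\<Sum>l\<in>UNIV. \<Sum>i\<in>UNIV. e l i l * x i) = E"
    unfolding E_def by (subst sum.swap) (simp add: e mult.commute)
  have 2: "(\<Sum>l\<in>UNIV. \<Sum>i\<in>UNIV. \<Sum>m\<in>UNIV. \<gamma>' l l i m * x m * x i) = P"
    unfolding P_def by (subst sum.swap) (simp add: mult_ac)
  have 3: "(\<Sum>l\<in>UNIV. \<Sum>i\<in>UNIV. \<Sum>m\<in>UNIV. \<gamma> l i m * d l m * x i) = U - V"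
    unfolding U_def V_def s
    by (subst sum.swap) (simp add: sum_subtractf algebra_simps sum_distrib_left)
  have "(\<Sum>l\<in>UNIV. \<Sum>i\<in>UNIV. \<Sum>m\<in>UNIV. s l i * (\<gamma> i l m * x m)) = (\<Sum>m\<in>UNIV. \<Sum>i\<in>UNIV. \<Sum>l\<in>UNIV. s l i * (\<gamma> i l m * x m))"
    by (rule sum3_reverse)
  also have "\<dots> = U"
    unfolding U_def by (intro sum.cong refl) (simp add: mult_ac \<gamma>)
  finally have "(\<Sum>l\<in>UNIV. \<Sum>i\<in>UNIV. \<Sum>m\<in>UNIV. s l i * (\<gamma> i l m * x m)) = U" .
  moreover have "(\<Sum>l\<in>UNIV. \<Sum>i\<in>UNIV. s l i * s i l) = ?R3"
    by (simp add: mult.commute)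
  ultimately have 4: "(\<Sum>l\<in>UNIV. \<Sum>i\<in>UNIV. s l i * d l i) = ?R3 - U"
    unfolding s by (simp add: right_diff_distrib sum_subtractf sum_distrib_left)
  have "?L2 = (\<Sum>l\<in>UNIV. \<Sum>m\<in>UNIV. \<Sum>i\<in>UNIV. \<gamma> l l m * s m i * x i)"
    by (simp add: sum_distrib_left mult_ac)
  also have "\<dots> = Y"
    unfolding Y_def by (subst sum3_rotate) (simp add: mult_ac)
  finally have 5: "?L2 = Y" .
  have "?L1 = (\<Sum>l\<in>UNIV. \<Sum>i\<in>UNIV. e l i l * x i) + (\<Sum>l\<in>UNIV. \<Sum>i\<in>UNIV. \<Sum>m\<in>UNIV. \<gamma>' l l i m * x m * x i)
     + (\<Sum>l\<in>UNIV. \<Sum>i\<in>UNIV. \<Sum>m\<in>UNIV. \<gamma> l i m * d l m * x i) + (\<Sum>l\<in>UNIV. \<Sum>i\<in>UNIV. s l i * d l i)"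
    by (simp add: sum.distrib distrib_right sum_distrib_right)
  then have L: "?L1 + ?L2 = E + P + (U - V) + (?R3 - U) + Y"
    unfolding 1 2 3 4 5 by simp
  have "?R1 = E + Q + (\<Sum>i\<in>UNIV. \<Sum>l\<in>UNIV. \<Sum>m\<in>UNIV. x i * (\<gamma> l l m * d i m))"
    unfolding E_def Q_def by (simp add: sum.distrib distrib_left sum_distrib_left mult.assoc)
  moreover have "(\<Sum>i\<in>UNIV. \<Sum>l\<in>UNIV. \<Sum>m\<in>UNIV. x i * (\<gamma> l l m * d i m)) = Y - R"
    unfolding Y_def R_def s by (simp add: sum_subtractf algebra_simps sum_distrib_left)
  ultimately have R1: "?R1 = E + Q + (Y - R)" by simp
  have "?R2 = (\<Sum>i\<in>UNIV. \<Sum>m\<in>UNIV. \<Sum>l\<in>UNIV. x i * \<gamma>' l l i m * x m - x i * \<gamma>' i l l m * x m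
      + (\<Sum>p\<in>UNIV. x i * \<gamma> l l p * \<gamma> p i m * x m - x i * \<gamma> l i p * \<gamma> p l m * x m))"
    by (simp add: sum_distrib_right sum_distrib_left algebra_simps)
  also have "\<dots> = (\<Sum>i\<in>UNIV. \<Sum>l\<in>UNIV. \<Sum>m\<in>UNIV. x i * \<gamma>' l l i m * x m - x i * \<gamma>' i l l m * x m
      + (\<Sum>p\<in>UNIV. x i * \<gamma> l l p * \<gamma> p i m * x m - x i * \<gamma> l i p * \<gamma> p l m * x m))"
    by (intro sum.cong refl sum.swap)
  also have "\<dots> = P - Q + (\<Sum>i\<in>UNIV. \<Sum>l\<in>UNIV. \<Sum>m\<in>UNIV. \<Sum>p\<in>UNIV. x i * \<gamma> l l p * \<gamma> p i m * x m)
      - (\<Sum>i\<in>UNIV. \<Sum>l\<in>UNIV. \<Sum>m\<in>UNIV. \<Sum>p\<in>UNIV. x i * \<gamma> l i p * \<gamma> p l m * x m)"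
    unfolding P_def Q_def by (simp add: sum.distrib sum_subtractf)
  also have "(\<Sum>i\<in>UNIV. \<Sum>l\<in>UNIV. \<Sum>m\<in>UNIV. \<Sum>p\<in>UNIV. x i * \<gamma> l l p * \<gamma> p i m * x m) = R"
    unfolding R_def by (intro sum.cong refl sum.swap)
  also have "(\<Sum>i\<in>UNIV. \<Sum>l\<in>UNIV. \<Sum>m\<in>UNIV. \<Sum>p\<in>UNIV. x i * \<gamma> l i p * \<gamma> p l m * x m) = V"
    unfolding V_def by (intro sum.cong refl sum.swap)
  finally have R2: "?R2 = P - Q + R - V" .
  show ?thesis unfolding L R1 R2 by simp
qed

lemma sum_single:
  fixes f :: "'n::finite \<Rightarrow> real"
  shows "(\<Sum>j\<in>UNIV. f j * (if j = k then c else 0)) = f k * c"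
    and "(\<Sum>j\<in>UNIV. (if j = k then c else 0) * f j) = c * f k"
    and "(\<Sum>j\<in>UNIV. (if k = j then c else 0) * f j) = c * f k"
  by (simp_all add: if_distrib if_distribR cong: if_cong)

lemma quadratic_form_shift:
  fixes B :: "'n::finite \<Rightarrow> 'n \<Rightarrow> real"
  assumes sym: "\<And>i j. B i j = B j i"
  shows "(\<Sum>i\<in>UNIV. \<Sum>j\<in>UNIV. (v i + (if i = k then c else 0)) * B i j * (v j + (if j = k then c else 0)))
    = (\<Sum>i\<in>UNIV. \<Sum>j\<in>UNIV. v i * B i j * v j) + 2 * c * (\<Sum>i\<in>UNIV. v i * B i k) + c\<^sup>2 * B k k"
proof -
  have "(\<Sum>i\<in>UNIV. \<Sum>j\<in>UNIV. (v i + (if i = k then c else 0)) * B i j * (v j + (if j = k then c else 0)))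
    = (\<Sum>i\<in>UNIV. \<Sum>j\<in>UNIV. v i * B i j * v j) + (\<Sum>i\<in>UNIV. \<Sum>j\<in>UNIV. v i * B i j * (if j = k then c else 0))
      + (\<Sum>i\<in>UNIV. \<Sum>j\<in>UNIV. (if i = k then c else 0) * B i j * v j)
      + (\<Sum>i\<in>UNIV. \<Sum>j\<in>UNIV. (if i = k then c else 0) * B i j * (if j = k then c else 0))"
    by (simp add: algebra_simps sum.distrib)
  also have "(\<Sum>i\<in>UNIV. \<Sum>j\<in>UNIV. v i * B i j * (if j = k then c else 0)) = c * (\<Sum>i\<in>UNIV. v i * B i k)"
    unfolding sum_single by (simp add: sum_distrib_left mult.commute)
  also have "(\<Sum>i\<in>UNIV. \<Sum>j\<in>UNIV. (if i = k then c else 0) * B i j * v j) = (\<Sum>j\<in>UNIV. \<Sum>i\<in>UNIV. (if i = k then c else 0) * B i j * v j)"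
    by (rule sum.swap)
  also have "\<dots> = c * (\<Sum>i\<in>UNIV. v i * B i k)"
    unfolding mult.assoc sum_single by (simp add: sum_distrib_left mult.commute sym[of k])
  also have "(\<Sum>i\<in>UNIV. \<Sum>j\<in>UNIV. (if i = k then c else 0) * B i j * (if j = k then c else 0)) = c\<^sup>2 * B k k"
    unfolding sum_single unfolding mult.assoc sum_single by (simp add: power2_eq_square)
  finally show ?thesis by simp
qed

text \<open>A positive semidefinite form is a sum of squares of linear forms.  This is Gaussian elimination:
  completing the square in the variable \<open>k\<close> leaves a semidefinite form supported on the
  remaining indices.\<close>
lemma psd_sum_of_squares:
  fixes B :: "'n::finite \<Rightarrow> 'n \<Rightarrow> real"
  assumes "finite K" "\<And>i j. B i j = B j i" "\<And>v. 0 \<le> (\<Sum>i\<in>UNIV. \<Sum>j\<in>UNIV. v i * B i j * v j)"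
    and "\<And>i j. i \<notin> K \<Longrightarrow> B i j = 0"
  shows "\<exists>E. \<forall>i j. B i j = (\<Sum>k\<in>K. E k i * E k j)"
  using assms
proof (induction K arbitrary: B)
  case empty
  then show ?case by simp
next
  case (insert k K)
  note sym = insert.prems(1) and psd = insert.prems(2)
  have Bkk: "B k k \<ge> 0"
    using psd[of "\<lambda>i. 0 + (if i = k then 1 else 0)"]
    unfolding quadratic_form_shift[OF sym] by simp
  show ?case
  proof (cases "B k k = 0")
    case True
    (* A vanishing diagonal entry forces its row to vanish: otherwise the form takes the value -1
       at the i-th unit vector plus c times the k-th one. *)
    have row: "B i k = 0" for i
    proof (rule ccontr)
      assume ne: "B i k \<noteq> 0"
      define c where "c = - (B i i + 1) / (2 * B i k)"
      define v :: "'n \<Rightarrow> real" where "v = (\<lambda>j. 0 + (if j = i then 1 else 0))"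
      have "0 \<le> (\<Sum>a\<in>UNIV. \<Sum>b\<in>UNIV. (v a + (if a = k then c else 0)) * B a b * (v b + (if b = k then c else 0)))"
        by (rule psd)
      also have "\<dots> = (\<Sum>a\<in>UNIV. \<Sum>b\<in>UNIV. v a * B a b * v b) + 2 * c * (\<Sum>a\<in>UNIV. v a * B a k)"
        unfolding quadratic_form_shift[OF sym] using True by simp
      also have "(\<Sum>a\<in>UNIV. \<Sum>b\<in>UNIV. v a * B a b * v b) = B i i"
        unfolding v_def quadratic_form_shift[OF sym] by simp
      also have "(\<Sum>a\<in>UNIV. v a * B a k) = B i k"
        by (simp add: v_def if_distrib if_distribR cong: if_cong)
      also have "B i i + 2 * c * B i k = -1"
        using ne by (simp add: c_def field_simps)
      finally show False by simp
    qed
    have "B i j = 0" if "i \<notin> K" for i j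
      using row[of j] sym[of k j] insert.prems(3)[of i j] that by (cases "i = k") auto
    from insert.IH[OF sym psd this] obtain E where E: "\<And>i j. B i j = (\<Sum>l\<in>K. E l i * E l j)"
      by auto
    have "B i j = (\<Sum>l\<in>insert k K. (if l = k then 0 else E l i) * (if l = k then 0 else E l j))" for i j
      using insert.hyps unfolding E by (auto intro!: sum.cong)
    then show ?thesis
      by (intro exI[of _ "\<lambda>l i. if l = k then 0 else E l i"]) blast
  next
    case False
    then have pos: "B k k > 0" using Bkk by simp
    define f where "f i = B i k / sqrt (B k k)" for i
    have ff: "f i * f j = B i k * B j k / B k k" for i j
      using pos by (simp add: f_def field_simps)
    define B' where "B' i j = B i j - f i * f j" for i j
    have "B' i j = B' j i" for i j
      by (simp add: B'_def sym mult.commute)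
    moreover have "0 \<le> (\<Sum>i\<in>UNIV. \<Sum>j\<in>UNIV. v i * B' i j * v j)" for v
    proof -
      (* The value of the form of B' at v is the minimum over c of the value of B at v + c e_k. *)
      define b where "b = (\<Sum>i\<in>UNIV. v i * B i k)"
      define c where "c = - b / B k k"
      have "0 \<le> (\<Sum>i\<in>UNIV. \<Sum>j\<in>UNIV. (v i + (if i = k then c else 0)) * B i j * (v j + (if j = k then c else 0)))"
        by (rule psd)
      also have "\<dots> = (\<Sum>i\<in>UNIV. \<Sum>j\<in>UNIV. v i * B i j * v j) - b * b / B k k"
        unfolding quadratic_form_shift[OF sym] b_def[symmetric] using pos
        by (simp add: c_def power2_eq_square field_simps)
      also have "b * b / B k k = (\<Sum>i\<in>UNIV. \<Sum>j\<in>UNIV. v i * (f i * f j) * v j)"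
        unfolding b_def sum_product ff by (simp add: sum_divide_distrib mult_ac)
      also have "(\<Sum>i\<in>UNIV. \<Sum>j\<in>UNIV. v i * B i j * v j) - \<dots> = (\<Sum>i\<in>UNIV. \<Sum>j\<in>UNIV. v i * B' i j * v j)"
        by (simp add: B'_def sum_subtractf algebra_simps)
      finally show ?thesis .
    qed
    moreover have "B' i j = 0" if "i \<notin> K" for i j
    proof (cases "i = k")
      case True
      then show ?thesis using pos by (simp add: B'_def ff sym[of k j])
    next
      case False
      then show ?thesis using that insert.prems(3)[of i] by (simp add: B'_def ff)
    qed
    ultimately obtain E where E: "\<And>i j. B' i j = (\<Sum>l\<in>K. E l i * E l j)"
      using insert.IH[of B'] by auto
    have "B i j = (\<Sum>l\<in>insert k K. (if l = k then f i else E l i) * (if l = k then f j else E l j))" for i j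
    proof -
      have "(\<Sum>l\<in>K. (if l = k then f i else E l i) * (if l = k then f j else E l j)) = B' i j"
        unfolding E using insert.hyps by (intro sum.cong) auto
      then show ?thesis using insert.hyps by (simp add: B'_def)
    qed
    then show ?thesis
      by (intro exI[of _ "\<lambda>l i. if l = k then f i else E l i"]) blast
  qed
qed

text \<open>Applied to the Hessian at a spatial maximum, this is the inequality $\Delta W \le 0$.\<close>
lemma psd_trace_nonpos:
  fixes B H :: "'n::finite \<Rightarrow> 'n \<Rightarrow> real"
  assumes "\<And>i j. B i j = B j i" "\<And>v. 0 \<le> (\<Sum>i\<in>UNIV. \<Sum>j\<in>UNIV. v i * B i j * v j)"
    and H: "\<And>v. (\<Sum>i\<in>UNIV. \<Sum>j\<in>UNIV. v i * H i j * v j) \<le> 0"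
  shows "(\<Sum>i\<in>UNIV. \<Sum>j\<in>UNIV. B i j * H i j) \<le> 0"
proof -
  have "\<exists>E::'n \<Rightarrow> 'n \<Rightarrow> real. \<forall>i j. B i j = (\<Sum>k\<in>UNIV. E k i * E k j)"
    by (rule psd_sum_of_squares[of UNIV B, OF finite assms(1,2)]) simp
  then obtain E :: "'n \<Rightarrow> 'n \<Rightarrow> real" where E: "\<And>i j. B i j = (\<Sum>k\<in>UNIV. E k i * E k j)" by blast
  have "(\<Sum>i\<in>UNIV. \<Sum>j\<in>UNIV. B i j * H i j) = (\<Sum>i\<in>UNIV. \<Sum>j\<in>UNIV. \<Sum>k\<in>UNIV. E k i * H i j * E k j)"
    unfolding E by (simp add: sum_distrib_left sum_distrib_right mult_ac)
  also have "\<dots> = (\<Sum>k\<in>UNIV. \<Sum>i\<in>UNIV. \<Sum>j\<in>UNIV. E k i * H i j * E k j)"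
    by (rule sum3_rotate)
  also have "\<dots> \<le> 0"
    by (intro sum_nonpos H)
  finally show ?thesis .
qed

text \<open>With \<open>B\<close> the inverse metric and \<open>h\<close> a Hessian, the trace of the square of $g^{-1}h$ is
  $|h|^2$.  If \<open>B\<close> is the sum of the $e_ae_a^T$, the trace is the sum of the squares of
  $h(e_a,e_b)$.\<close>
lemma psd_trace_square_nonneg:
  fixes B h s :: "'n::finite \<Rightarrow> 'n \<Rightarrow> real"
  assumes "\<And>i j. B i j = B j i" "\<And>v. 0 \<le> (\<Sum>i\<in>UNIV. \<Sum>j\<in>UNIV. v i * B i j * v j)"
    and h: "\<And>i j. h i j = h j i" and s: "\<And>i k. s i k = (\<Sum>j\<in>UNIV. B i j * h k j)"
  shows "0 \<le> (\<Sum>i\<in>UNIV. \<Sum>l\<in>UNIV. s l i * s i l)"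
proof -
  have "\<exists>E::'n \<Rightarrow> 'n \<Rightarrow> real. \<forall>i j. B i j = (\<Sum>k\<in>UNIV. E k i * E k j)"
    by (rule psd_sum_of_squares[of UNIV B, OF finite assms(1,2)]) simp
  then obtain E :: "'n \<Rightarrow> 'n \<Rightarrow> real" where E: "\<And>i j. B i j = (\<Sum>k\<in>UNIV. E k i * E k j)" by blast
  define w where "w a i = (\<Sum>j\<in>UNIV. E a j * h i j)" for a i
  define c where "c a b = (\<Sum>i\<in>UNIV. E a i * w b i)" for a b
  have c: "c a b = c b a" for a b
  proof -
    have "c a b = (\<Sum>i\<in>UNIV. \<Sum>j\<in>UNIV. E a i * (E b j * h i j))"
      by (simp add: c_def w_def sum_distrib_left)
    also have "\<dots> = (\<Sum>j\<in>UNIV. \<Sum>i\<in>UNIV. E a i * (E b j * h i j))"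
      by (rule sum.swap)
    also have "\<dots> = c b a"
      by (simp add: c_def w_def sum_distrib_left h mult_ac)
    finally show ?thesis .
  qed
  have sE: "s l i = (\<Sum>a\<in>UNIV. E a l * w a i)" for l i
  proof -
    have "s l i = (\<Sum>j\<in>UNIV. \<Sum>a\<in>UNIV. E a l * (E a j * h i j))"
      unfolding s E by (simp add: sum_distrib_left sum_distrib_right mult_ac)
    also have "\<dots> = (\<Sum>a\<in>UNIV. \<Sum>j\<in>UNIV. E a l * (E a j * h i j))"
      by (rule sum.swap)
    finally show ?thesis by (simp add: w_def sum_distrib_left)
  qed
  have "(\<Sum>l\<in>UNIV. s l i * s i l) = (\<Sum>a\<in>UNIV. \<Sum>b\<in>UNIV. (w a i * E b i) * c a b)" for i
  proof -
    have "(\<Sum>l\<in>UNIV. s l i * s i l) = (\<Sum>l\<in>UNIV. \<Sum>a\<in>UNIV. \<Sum>b\<in>UNIV. (w a i * E b i) * (E a l * w b l))"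
      unfolding sE sum_product by (simp add: mult_ac)
    also have "\<dots> = (\<Sum>a\<in>UNIV. \<Sum>b\<in>UNIV. \<Sum>l\<in>UNIV. (w a i * E b i) * (E a l * w b l))"
      by (rule sum3_rotate[symmetric])
    finally show ?thesis by (simp add: c_def sum_distrib_left)
  qed
  then have "(\<Sum>i\<in>UNIV. \<Sum>l\<in>UNIV. s l i * s i l) = (\<Sum>i\<in>UNIV. \<Sum>a\<in>UNIV. \<Sum>b\<in>UNIV. (w a i * E b i) * c a b)"
    by simp
  also have "\<dots> = (\<Sum>a\<in>UNIV. \<Sum>b\<in>UNIV. \<Sum>i\<in>UNIV. (w a i * E b i) * c a b)"
    by (rule sum3_rotate[symmetric])
  also have "\<dots> = (\<Sum>a\<in>UNIV. \<Sum>b\<in>UNIV. c b a * c a b)"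
    by (simp add: c_def[of b a for a b] sum_distrib_left sum_distrib_right mult_ac)
  also have "\<dots> = (\<Sum>a\<in>UNIV. \<Sum>b\<in>UNIV. (c a b)\<^sup>2)"
    by (simp add: c[of b a for a b] power2_eq_square)
  also have "\<dots> \<ge> 0"
    by (intro sum_nonneg) simp
  finally show ?thesis .
qed


section \<open>Riemannian geometry in a single chart\<close>

abbreviation dx :: "'n::finite \<Rightarrow> (real \<times> (real^'n) \<Rightarrow> real) \<Rightarrow> real \<times> (real^'n) \<Rightarrow> real" where
  "dx i \<equiv> dirderiv (0, axis i 1)"

abbreviation dt :: "(real \<times> (real^'n::finite) \<Rightarrow> real) \<Rightarrow> real \<times> (real^'n) \<Rightarrow> real" where
  "dt \<equiv> dirderiv (1, 0)"

text \<open>A family of metrics depending on time, in one chart: points are pairs of a time and a coordinate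
  vector, and \<open>B\<close> is the inverse matrix of \<open>G\<close>.  Keeping time as an extra variable makes every
  quantity below a smooth function on one open set, where time and space derivatives commute.\<close>
locale local_metric =
  fixes S :: "(real \<times> (real^'n::finite)) set"
    and G B :: "'n \<Rightarrow> 'n \<Rightarrow> real \<times> (real^'n) \<Rightarrow> real"
  assumes open_S: "open S"
    and smooth_G: "smooth_on S (G i j)"
    and smooth_B: "smooth_on S (B i j)"
    and G_sym: "z \<in> S \<Longrightarrow> G i j z = G j i z"
    and B_sym: "z \<in> S \<Longrightarrow> B i j z = B j i z"
    and BG: "z \<in> S \<Longrightarrow> (\<Sum>k\<in>UNIV. B i k z * G k j z) = (if i = j then 1 else 0)"
    and B_psd: "z \<in> S \<Longrightarrow> 0 \<le> (\<Sum>i\<in>UNIV. \<Sum>j\<in>UNIV. v i * B i j z * v j)"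
begin

definition christof :: "'n \<Rightarrow> 'n \<Rightarrow> 'n \<Rightarrow> real \<times> (real^'n) \<Rightarrow> real" where
  "christof k i j z = (1/2) * (\<Sum>l\<in>UNIV. B k l z * (dx i (G j l) z + dx j (G i l) z - dx l (G i j) z))"

definition ric :: "'n \<Rightarrow> 'n \<Rightarrow> real \<times> (real^'n) \<Rightarrow> real" where
  "ric j k z = (\<Sum>l\<in>UNIV. dx l (christof l j k) z - dx j (christof l l k) z
      + (\<Sum>m\<in>UNIV. christof l l m z * christof m j k z - christof l j m z * christof m l k z))"

definition hess :: "(real \<times> (real^'n) \<Rightarrow> real) \<Rightarrow> 'n \<Rightarrow> 'n \<Rightarrow> real \<times> (real^'n) \<Rightarrow> real" where
  "hess u i j z = dx i (dx j u) z - (\<Sum>k\<in>UNIV. christof k i j z * dx k u z)"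

definition lap :: "(real \<times> (real^'n) \<Rightarrow> real) \<Rightarrow> real \<times> (real^'n) \<Rightarrow> real" where
  "lap u z = (\<Sum>i\<in>UNIV. \<Sum>j\<in>UNIV. B i j z * hess u i j z)"

definition grad :: "(real \<times> (real^'n) \<Rightarrow> real) \<Rightarrow> 'n \<Rightarrow> real \<times> (real^'n) \<Rightarrow> real" where
  "grad u i z = (\<Sum>j\<in>UNIV. B i j z * dx j u z)"

definition grad_sq :: "(real \<times> (real^'n) \<Rightarrow> real) \<Rightarrow> real \<times> (real^'n) \<Rightarrow> real" where
  "grad_sq u z = (\<Sum>i\<in>UNIV. \<Sum>j\<in>UNIV. B i j z * dx i u z * dx j u z)"

text \<open>The components $\nabla_k X^i$ of the covariant derivative of $X = \nabla u$.\<close>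
definition cov_grad :: "(real \<times> (real^'n) \<Rightarrow> real) \<Rightarrow> 'n \<Rightarrow> 'n \<Rightarrow> real \<times> (real^'n) \<Rightarrow> real" where
  "cov_grad u i k z = dx k (grad u i) z + (\<Sum>m\<in>UNIV. christof i k m z * grad u m z)"

lemmas smooth_rules = smooth_G smooth_B smooth_on_dirderiv[OF open_S] smooth_on_const[OF open_S]
  smooth_on_add[OF open_S] smooth_on_diff[OF open_S] smooth_on_mult[OF open_S] smooth_on_sum[OF open_S]

lemma smooth_christof: "smooth_on S (christof k i j)"
  unfolding christof_def[abs_def] by (intro smooth_rules)

lemma smooth_hess: "smooth_on S u \<Longrightarrow> smooth_on S (hess u i j)"
  unfolding hess_def[abs_def] by (intro smooth_rules smooth_christof)

lemma smooth_lap: "smooth_on S u \<Longrightarrow> smooth_on S (lap u)"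
  unfolding lap_def[abs_def] by (intro smooth_rules smooth_hess)

lemma smooth_grad: "smooth_on S u \<Longrightarrow> smooth_on S (grad u i)"
  unfolding grad_def[abs_def] by (intro smooth_rules)

lemma smooth_grad_sq: "smooth_on S u \<Longrightarrow> smooth_on S (grad_sq u)"
  unfolding grad_sq_def[abs_def] by (intro smooth_rules)

lemma smooth_cov_grad: "smooth_on S u \<Longrightarrow> smooth_on S (cov_grad u i k)"
  unfolding cov_grad_def[abs_def] by (intro smooth_rules smooth_grad smooth_christof)

context
  fixes z assumes z: "z \<in> S"
begin

lemma dirderiv_G_sym: "dirderiv v (G i j) z = dirderiv v (G j i) z"
  by (rule dirderiv_cong[OF open_S z G_sym])

lemma GB: "(\<Sum>k\<in>UNIV. G i k z * B k j z) = (if i = j then 1 else 0)"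
  using BG[OF z, of j i] by (simp add: G_sym[OF z, of i] B_sym[OF z, of _ j] mult.commute eq_commute)

lemma christof_sym: "christof k i j z = christof k j i z"
  unfolding christof_def by (simp add: dirderiv_G_sym[of _ i j] add.commute)

lemma B_contract: "(\<Sum>b\<in>UNIV. B i b z * (\<Sum>m\<in>UNIV. G b m z * q m)) = q i"
proof -
  have "(\<Sum>b\<in>UNIV. B i b z * (\<Sum>m\<in>UNIV. G b m z * q m)) = (\<Sum>b\<in>UNIV. \<Sum>m\<in>UNIV. B i b z * G b m z * q m)"
    by (simp add: sum_distrib_left mult.assoc)
  also have "\<dots> = (\<Sum>m\<in>UNIV. \<Sum>b\<in>UNIV. B i b z * G b m z * q m)"
    by (rule sum.swap)
  also have "\<dots> = (\<Sum>m\<in>UNIV. (if i = m then 1 else 0) * q m)"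
    by (simp only: sum_distrib_right[symmetric] BG[OF z])
  also have "\<dots> = q i" by (simp only: sum_single mult_1)
  finally show ?thesis .
qed

lemma G_contract: "(\<Sum>b\<in>UNIV. G i b z * (\<Sum>m\<in>UNIV. B b m z * q m)) = q i"
proof -
  have "(\<Sum>b\<in>UNIV. G i b z * (\<Sum>m\<in>UNIV. B b m z * q m)) = (\<Sum>b\<in>UNIV. \<Sum>m\<in>UNIV. G i b z * B b m z * q m)"
    by (simp add: sum_distrib_left mult.assoc)
  also have "\<dots> = (\<Sum>m\<in>UNIV. \<Sum>b\<in>UNIV. G i b z * B b m z * q m)"
    by (rule sum.swap)
  also have "\<dots> = (\<Sum>m\<in>UNIV. (if i = m then 1 else 0) * q m)"
    by (simp only: sum_distrib_right[symmetric] GB)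
  also have "\<dots> = q i" by (simp only: sum_single mult_1)
  finally show ?thesis .
qed

lemma lower_christof:
  "(\<Sum>m\<in>UNIV. G p m z * christof m i j z) = (1/2) * (dx i (G j p) z + dx j (G i p) z - dx p (G i j) z)"
proof -
  have "(\<Sum>m\<in>UNIV. G p m z * christof m i j z)
     = (\<Sum>m\<in>UNIV. G p m z * (\<Sum>l\<in>UNIV. B m l z * ((1/2) * (dx i (G j l) z + dx j (G i l) z - dx l (G i j) z))))"
    unfolding christof_def by (simp add: sum_distrib_left mult_ac)
  then show ?thesis unfolding G_contract .
qed

text \<open>The defining property of the Levi-Civita connection, $\nabla g = 0$; the next lemmas transfer it to
  $\nabla g^{-1} = 0$ by differentiating $g^{-1}g = 1$.\<close>
lemma metric_compatible:
  "dx k (G i j) z = (\<Sum>m\<in>UNIV. G j m z * christof m k i z) + (\<Sum>m\<in>UNIV. G i m z * christof m k j z)"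
  unfolding lower_christof
  by (simp add: dirderiv_G_sym[of _ j i] dirderiv_G_sym[of _ k i] dirderiv_G_sym[of _ k j] field_simps)

lemma dirderiv_B: "dirderiv v (B i j) z = - (\<Sum>b\<in>UNIV. \<Sum>c\<in>UNIV. B i b z * dirderiv v (G b c) z * B c j z)"
proof -
  have 0: "0 = (\<Sum>b\<in>UNIV. dirderiv v (B i b) z * G b c z) + (\<Sum>b\<in>UNIV. B i b z * dirderiv v (G b c) z)" for c
  proof -
    have "0 = dirderiv v (\<lambda>x. if i = c then 1 else 0) z"
      by (simp add: dirderiv_const)
    also have "\<dots> = dirderiv v (\<lambda>x. \<Sum>b\<in>UNIV. B i b x * G b c x) z"
      by (rule dirderiv_cong[OF open_S z]) (simp add: BG)
    also have "\<dots> = (\<Sum>b\<in>UNIV. dirderiv v (\<lambda>x. B i b x * G b c x) z)"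
      by (intro dirderiv_sum[OF open_S z] smooth_rules)
    also have "\<dots> = (\<Sum>b\<in>UNIV. dirderiv v (B i b) z * G b c z + B i b z * dirderiv v (G b c) z)"
      by (intro sum.cong refl dirderiv_mult[OF open_S z] smooth_rules)
    finally show ?thesis by (simp add: sum.distrib)
  qed
  have "dirderiv v (B i j) z = (\<Sum>b\<in>UNIV. dirderiv v (B i b) z * (\<Sum>c\<in>UNIV. G b c z * B c j z))"
    unfolding GB sum_single by simp
  also have "\<dots> = (\<Sum>b\<in>UNIV. \<Sum>c\<in>UNIV. dirderiv v (B i b) z * G b c z * B c j z)"
    by (simp add: sum_distrib_left mult.assoc)
  also have "\<dots> = (\<Sum>c\<in>UNIV. \<Sum>b\<in>UNIV. dirderiv v (B i b) z * G b c z * B c j z)"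
    by (rule sum.swap)
  also have "\<dots> = (\<Sum>c\<in>UNIV. (\<Sum>b\<in>UNIV. dirderiv v (B i b) z * G b c z) * B c j z)"
    by (simp add: sum_distrib_right)
  also have "\<dots> = (\<Sum>c\<in>UNIV. - (\<Sum>b\<in>UNIV. B i b z * dirderiv v (G b c) z) * B c j z)"
    using 0 by (intro sum.cong refl arg_cong2[of _ _ _ _ "(*)"]) (smt (verit))
  also have "\<dots> = - (\<Sum>c\<in>UNIV. \<Sum>b\<in>UNIV. B i b z * dirderiv v (G b c) z * B c j z)"
    by (simp add: sum_distrib_right sum_negf)
  also have "(\<Sum>c\<in>UNIV. \<Sum>b\<in>UNIV. B i b z * dirderiv v (G b c) z * B c j z) = (\<Sum>b\<in>UNIV. \<Sum>c\<in>UNIV. B i b z * dirderiv v (G b c) z * B c j z)"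
    by (rule sum.swap)
  finally show ?thesis .
qed

lemma inverse_metric_compatible:
  "dx k (B i j) z = - (\<Sum>m\<in>UNIV. christof i k m z * B m j z) - (\<Sum>m\<in>UNIV. B i m z * christof j k m z)"
proof -
  have "(\<Sum>b\<in>UNIV. \<Sum>c\<in>UNIV. B i b z * dx k (G b c) z * B c j z)
     = (\<Sum>b\<in>UNIV. \<Sum>c\<in>UNIV. B i b z * (\<Sum>m\<in>UNIV. G c m z * christof m k b z) * B c j z)
       + (\<Sum>b\<in>UNIV. \<Sum>c\<in>UNIV. B i b z * (\<Sum>m\<in>UNIV. G b m z * christof m k c z) * B c j z)"
    unfolding metric_compatible by (simp add: algebra_simps sum.distrib)
  also have "(\<Sum>b\<in>UNIV. \<Sum>c\<in>UNIV. B i b z * (\<Sum>m\<in>UNIV. G c m z * christof m k b z) * B c j z)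
      = (\<Sum>b\<in>UNIV. B i b z * (\<Sum>c\<in>UNIV. B j c z * (\<Sum>m\<in>UNIV. G c m z * christof m k b z)))"
    by (simp add: sum_distrib_left mult_ac B_sym[OF z, of _ j])
  also have "\<dots> = (\<Sum>m\<in>UNIV. B i m z * christof j k m z)"
    unfolding B_contract ..
  also have "(\<Sum>b\<in>UNIV. \<Sum>c\<in>UNIV. B i b z * (\<Sum>m\<in>UNIV. G b m z * christof m k c z) * B c j z)
      = (\<Sum>c\<in>UNIV. \<Sum>b\<in>UNIV. B i b z * (\<Sum>m\<in>UNIV. G b m z * christof m k c z) * B c j z)"
    by (rule sum.swap)
  also have "\<dots> = (\<Sum>c\<in>UNIV. (\<Sum>b\<in>UNIV. B i b z * (\<Sum>m\<in>UNIV. G b m z * christof m k c z)) * B c j z)"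
    by (simp add: sum_distrib_right)
  also have "\<dots> = (\<Sum>m\<in>UNIV. christof i k m z * B m j z)"
    unfolding B_contract ..
  finally show ?thesis unfolding dirderiv_B by simp
qed

context
  fixes u :: "real \<times> (real^'n) \<Rightarrow> real" assumes u: "smooth_on S u"
begin

lemma hess_sym: "hess u i j z = hess u j i z"
  unfolding hess_def by (simp add: dirderiv_commute[OF open_S u z, of "(0, axis i 1)"] christof_sym[of _ i])

text \<open>The gradient commutes with raising the index, since $\nabla g^{-1} = 0$.\<close>
lemma cov_grad_eq: "cov_grad u i k z = (\<Sum>j\<in>UNIV. B i j z * hess u k j z)"
proof -
  have "dx k (grad u i) z = (\<Sum>j\<in>UNIV. dx k (\<lambda>x. B i j x * dx j u x) z)"
    unfolding grad_def[abs_def] by (intro dirderiv_sum[OF open_S z] smooth_rules u)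
  also have "\<dots> = (\<Sum>j\<in>UNIV. dx k (B i j) z * dx j u z + B i j z * dx k (dx j u) z)"
    by (intro sum.cong refl dirderiv_mult[OF open_S z] smooth_rules u)
  also have "\<dots> = (\<Sum>j\<in>UNIV. B i j z * dx k (dx j u) z)
      - (\<Sum>j\<in>UNIV. \<Sum>m\<in>UNIV. christof i k m z * B m j z * dx j u z)
      - (\<Sum>j\<in>UNIV. \<Sum>m\<in>UNIV. B i m z * christof j k m z * dx j u z)"
    unfolding inverse_metric_compatible
    by (simp add: sum.distrib sum_subtractf algebra_simps sum_distrib_left sum_distrib_right)
  also have "(\<Sum>j\<in>UNIV. \<Sum>m\<in>UNIV. christof i k m z * B m j z * dx j u z) = (\<Sum>m\<in>UNIV. \<Sum>j\<in>UNIV. christof i k m z * B m j z * dx j u z)"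
    by (rule sum.swap)
  also have "\<dots> = (\<Sum>m\<in>UNIV. christof i k m z * grad u m z)"
    unfolding grad_def by (simp add: sum_distrib_left mult.assoc)
  also have "(\<Sum>j\<in>UNIV. \<Sum>m\<in>UNIV. B i m z * christof j k m z * dx j u z) = (\<Sum>m\<in>UNIV. \<Sum>j\<in>UNIV. B i m z * christof j k m z * dx j u z)"
    by (rule sum.swap)
  finally show ?thesis
    unfolding cov_grad_def hess_def
    by (simp add: right_diff_distrib sum_subtractf sum_distrib_left mult.assoc)
qed

lemma lap_eq_div_grad: "lap u z = (\<Sum>k\<in>UNIV. cov_grad u k k z)"
  unfolding lap_def cov_grad_eq ..

lemma grad_sq_eq: "grad_sq u z = (\<Sum>i\<in>UNIV. grad u i z * dx i u z)"
  unfolding grad_sq_def grad_def by (simp add: sum_distrib_right sum_distrib_left mult_ac)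

end

end

lemma dx_grad_sq:
  assumes u: "smooth_on S u" and z: "z \<in> S"
  shows "dx k (grad_sq u) z = 2 * (\<Sum>i\<in>UNIV. grad u i z * hess u k i z)"
proof -
  have "dx k (grad_sq u) z = dx k (\<lambda>x. \<Sum>i\<in>UNIV. grad u i x * dx i u x) z"
    by (rule dirderiv_cong[OF open_S z grad_sq_eq[OF _ u]])
  also have "\<dots> = (\<Sum>i\<in>UNIV. dx k (\<lambda>x. grad u i x * dx i u x) z)"
    by (intro dirderiv_sum[OF open_S z] smooth_rules smooth_grad u)
  also have "\<dots> = (\<Sum>i\<in>UNIV. dx k (grad u i) z * dx i u z + grad u i z * dx k (dx i u) z)"
    by (intro sum.cong refl dirderiv_mult[OF open_S z] smooth_rules smooth_grad u)
  also have "\<dots> = (\<Sum>i\<in>UNIV. cov_grad u i k z * dx i u z) - (\<Sum>i\<in>UNIV. \<Sum>m\<in>UNIV. christof i k m z * grad u m z * dx i u z)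
       + (\<Sum>i\<in>UNIV. grad u i z * dx k (dx i u) z)"
    unfolding cov_grad_def by (simp add: sum.distrib algebra_simps sum_distrib_right sum_distrib_left)
  also have "(\<Sum>i\<in>UNIV. \<Sum>m\<in>UNIV. christof i k m z * grad u m z * dx i u z) = (\<Sum>m\<in>UNIV. \<Sum>i\<in>UNIV. christof i k m z * grad u m z * dx i u z)"
    by (rule sum.swap)
  also have "(\<Sum>i\<in>UNIV. cov_grad u i k z * dx i u z) = (\<Sum>i\<in>UNIV. \<Sum>j\<in>UNIV. B i j z * hess u k j z * dx i u z)"
    unfolding cov_grad_eq[OF z u] by (simp add: sum_distrib_right)
  also have "\<dots> = (\<Sum>j\<in>UNIV. \<Sum>i\<in>UNIV. B i j z * hess u k j z * dx i u z)"
    by (rule sum.swap)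
  also have "\<dots> = (\<Sum>j\<in>UNIV. grad u j z * hess u k j z)"
    unfolding grad_def by (simp add: sum_distrib_right sum_distrib_left B_sym[OF z, of _ j for j] mult_ac)
  also have "\<dots> - (\<Sum>m\<in>UNIV. \<Sum>i\<in>UNIV. christof i k m z * grad u m z * dx i u z) + (\<Sum>i\<in>UNIV. grad u i z * dx k (dx i u) z)
     = 2 * (\<Sum>i\<in>UNIV. grad u i z * hess u k i z)"
    unfolding hess_def by (simp add: right_diff_distrib sum_subtractf sum_distrib_left sum_negf mult_ac)
  finally show ?thesis .
qed

lemma grad_grad_sq:
  assumes u: "smooth_on S u" and z: "z \<in> S"
  shows "grad (grad_sq u) l z = 2 * (\<Sum>i\<in>UNIV. cov_grad u l i z * grad u i z)"
proof -
  have "grad (grad_sq u) l z = (\<Sum>k\<in>UNIV. \<Sum>i\<in>UNIV. 2 * (B l k z * (grad u i z * hess u k i z)))"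
    unfolding grad_def[of "grad_sq u"] dx_grad_sq[OF assms] by (simp add: sum_distrib_left mult_ac)
  also have "\<dots> = (\<Sum>i\<in>UNIV. \<Sum>k\<in>UNIV. 2 * (B l k z * (grad u i z * hess u k i z)))"
    by (rule sum.swap)
  also have "\<dots> = 2 * (\<Sum>i\<in>UNIV. cov_grad u l i z * grad u i z)"
    unfolding cov_grad_eq[OF z u]
    by (simp add: sum_distrib_left sum_distrib_right mult_ac hess_sym[OF z u, of _ i for i])
  finally show ?thesis .
qed

text \<open>The Bochner formula
  $\Delta|\nabla u|^2 = 2\langle\nabla u,\nabla\Delta u\rangle + 2\,\mathrm{Ric}(\nabla u,\nabla u) + 2|\nabla^2u|^2$.
  With $X = \nabla u$ one has $\nabla|X|^2 = 2\nabla_X X$, so the left-hand side is the divergence of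
  $2\nabla_X X$, to which the contraction identity applies.\<close>
theorem bochner:
  assumes u: "smooth_on S u" and z: "z \<in> S"
  shows "lap (grad_sq u) z = 2 * (\<Sum>i\<in>UNIV. grad u i z * dx i (lap u) z)
     + 2 * (\<Sum>i\<in>UNIV. \<Sum>j\<in>UNIV. ric i j z * grad u i z * grad u j z)
     + 2 * (\<Sum>i\<in>UNIV. \<Sum>l\<in>UNIV. cov_grad u l i z * cov_grad u i l z)"
proof -
  have d: "dx k (grad u i) z = cov_grad u i k z - (\<Sum>m\<in>UNIV. christof i k m z * grad u m z)" for i k
    by (simp add: cov_grad_def)
  have dS: "dx l (cov_grad u j i) z = dx l (dx i (grad u j)) z
     + (\<Sum>m\<in>UNIV. dx l (christof j i m) z * grad u m z + christof j i m z * dx l (grad u m) z)" for i j l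
  proof -
    have "dx l (cov_grad u j i) z = dx l (dx i (grad u j)) z + dx l (\<lambda>x. \<Sum>m\<in>UNIV. christof j i m x * grad u m x) z"
      unfolding cov_grad_def[abs_def]
      by (rule dirderiv_add[OF open_S z]) (intro smooth_rules smooth_grad[OF u] smooth_christof)+
    also have "dx l (\<lambda>x. \<Sum>m\<in>UNIV. christof j i m x * grad u m x) z = (\<Sum>m\<in>UNIV. dx l (\<lambda>x. christof j i m x * grad u m x) z)"
      by (intro dirderiv_sum[OF open_S z] smooth_rules smooth_grad[OF u] smooth_christof)
    also have "\<dots> = (\<Sum>m\<in>UNIV. dx l (christof j i m) z * grad u m z + christof j i m z * dx l (grad u m) z)"
      by (intro sum.cong refl dirderiv_mult[OF open_S z] smooth_grad[OF u] smooth_christof)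
    finally show ?thesis .
  qed
  have dlap: "dx i (lap u) z = (\<Sum>l\<in>UNIV. dx i (dx l (grad u l)) z
     + (\<Sum>m\<in>UNIV. dx i (christof l l m) z * grad u m z + christof l l m z * dx i (grad u m) z))" for i
  proof -
    have "dx i (lap u) z = dx i (\<lambda>x. \<Sum>l\<in>UNIV. cov_grad u l l x) z"
      by (rule dirderiv_cong[OF open_S z lap_eq_div_grad[OF _ u]])
    also have "\<dots> = (\<Sum>l\<in>UNIV. dx i (cov_grad u l l) z)"
      by (intro dirderiv_sum[OF open_S z] smooth_cov_grad u)
    finally show ?thesis unfolding dS .
  qed
  have dY: "dx l (grad (grad_sq u) l) z = 2 * (\<Sum>i\<in>UNIV. dx l (cov_grad u l i) z * grad u i z + cov_grad u l i z * dx l (grad u i) z)" for l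
  proof -
    have "dx l (grad (grad_sq u) l) z = dx l (\<lambda>x. 2 * (\<Sum>i\<in>UNIV. cov_grad u l i x * grad u i x)) z"
      by (rule dirderiv_cong[OF open_S z grad_grad_sq[OF u]])
    also have "\<dots> = 2 * dx l (\<lambda>x. \<Sum>i\<in>UNIV. cov_grad u l i x * grad u i x) z"
      by (subst dirderiv_mult[OF open_S z]) (auto intro!: smooth_rules smooth_grad[OF u] smooth_cov_grad[OF u] simp: dirderiv_const)
    also have "dx l (\<lambda>x. \<Sum>i\<in>UNIV. cov_grad u l i x * grad u i x) z = (\<Sum>i\<in>UNIV. dx l (\<lambda>x. cov_grad u l i x * grad u i x) z)"
      by (intro dirderiv_sum[OF open_S z] smooth_rules smooth_grad[OF u] smooth_cov_grad[OF u])
    also have "\<dots> = (\<Sum>i\<in>UNIV. dx l (cov_grad u l i) z * grad u i z + cov_grad u l i z * dx l (grad u i) z)"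
      by (intro sum.cong refl dirderiv_mult[OF open_S z] smooth_grad[OF u] smooth_cov_grad[OF u])
    finally show ?thesis .
  qed
  have "lap (grad_sq u) z = (\<Sum>l\<in>UNIV. dx l (grad (grad_sq u) l) z + (\<Sum>m\<in>UNIV. christof l l m z * grad (grad_sq u) m z))"
    unfolding lap_eq_div_grad[OF z smooth_grad_sq[OF u]] cov_grad_def[of "grad_sq u"] ..
  also have "\<dots> = 2 * ((\<Sum>l\<in>UNIV. \<Sum>i\<in>UNIV. (dx l (dx i (grad u l)) z
        + (\<Sum>m\<in>UNIV. dx l (christof l i m) z * grad u m z + christof l i m z * dx l (grad u m) z)) * grad u i z
        + cov_grad u l i z * dx l (grad u i) z)
      + (\<Sum>l\<in>UNIV. \<Sum>m\<in>UNIV. christof l l m z * (\<Sum>i\<in>UNIV. cov_grad u m i z * grad u i z)))"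
    unfolding dY grad_grad_sq[OF u z] dS
    by (simp add: sum.distrib sum_distrib_left mult_ac)
  also have "\<dots> = 2 * ((\<Sum>i\<in>UNIV. grad u i z * (\<Sum>l\<in>UNIV. dx i (dx l (grad u l)) z
            + (\<Sum>m\<in>UNIV. dx i (christof l l m) z * grad u m z + christof l l m z * dx i (grad u m) z)))
      + (\<Sum>i\<in>UNIV. \<Sum>m\<in>UNIV. (\<Sum>l\<in>UNIV. dx l (christof l i m) z - dx i (christof l l m) z
            + (\<Sum>p\<in>UNIV. christof l l p z * christof p i m z - christof l i p z * christof p l m z)) * grad u i z * grad u m z)
      + (\<Sum>i\<in>UNIV. \<Sum>l\<in>UNIV. cov_grad u l i z * cov_grad u i l z))"
    by (subst bochner_contraction[where x = "\<lambda>i. grad u i z" and d = "\<lambda>k i. dx k (grad u i) z"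
          and s = "\<lambda>i k. cov_grad u i k z" and \<gamma> = "\<lambda>k i j. christof k i j z"
          and e = "\<lambda>l i m. dx l (dx i (grad u m)) z" and \<gamma>' = "\<lambda>p l i m. dx p (christof l i m) z"])
       (simp_all add: d christof_sym[OF z] dirderiv_commute[OF open_S smooth_grad[OF u] z])
  finally show ?thesis
    unfolding dlap ric_def by simp
qed

end


section \<open>The local maximum principle under Ricci flow\<close>

lemma dirderiv_spatial:
  fixes S :: "(real \<times> (real^'n::finite)) set"
  assumes "open S" "smooth_on S h" "z \<in> S"
  shows "dirderiv (0, v) h z = (\<Sum>i\<in>UNIV. v $ i * dx i h z)"
proof -
  have lin: "linear (\<lambda>v. dirderiv v h z)"
    using has_derivative_linear[OF has_derivative_dirderiv[OF smooth_on_differentiable[OF assms]]] .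
  have "(\<Sum>i\<in>UNIV. v $ i *\<^sub>R axis i 1) = v"
    using basis_expansion[of v] by (simp add: scalar_mult_eq_scaleR)
  then have "(0, v) = (\<Sum>i\<in>UNIV. v $ i *\<^sub>R (0::real, axis i (1::real)))"
    by (simp add: prod_eq_iff fst_sum snd_sum)
  then have "dirderiv (0, v) h z = (\<Sum>i\<in>UNIV. dirderiv (v $ i *\<^sub>R (0::real, axis i (1::real))) h z)"
    using linear_sum[OF lin] by metis
  then show ?thesis
    unfolding linear_cmul[OF lin] by (simp only: real_scaleR_def)
qed

lemma dirderiv_spatial_twice:
  fixes S :: "(real \<times> (real^'n::finite)) set"
  assumes "open S" "smooth_on S h" "z \<in> S"
  shows "dirderiv (0, v) (dirderiv (0, v) h) z = (\<Sum>i\<in>UNIV. \<Sum>j\<in>UNIV. v $ i * dx i (dx j h) z * v $ j)"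
proof -
  have sm: "smooth_on S (dx j h)" for j by (intro smooth_on_dirderiv assms)
  have "dirderiv (0, v) (dirderiv (0, v) h) z = dirderiv (0, v) (\<lambda>x. \<Sum>j\<in>UNIV. v $ j * dx j h x) z"
    by (rule dirderiv_cong[OF assms(1,3) dirderiv_spatial[OF assms(1,2)]])
  also have "\<dots> = (\<Sum>j\<in>UNIV. dirderiv (0, v) (\<lambda>x. v $ j * dx j h x) z)"
    by (intro dirderiv_sum[OF assms(1,3)] smooth_on_mult smooth_on_const assms sm)
  also have "\<dots> = (\<Sum>j\<in>UNIV. v $ j * dirderiv (0, v) (dx j h) z)"
    unfolding dirderiv_mult[OF assms(1,3) smooth_on_const[OF assms(1)] sm] dirderiv_const by simp
  also have "\<dots> = (\<Sum>j\<in>UNIV. \<Sum>i\<in>UNIV. v $ i * dx i (dx j h) z * v $ j)"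
    unfolding dirderiv_spatial[OF assms(1) sm assms(3), of v] by (simp add: sum_distrib_left mult_ac)
  also have "\<dots> = (\<Sum>i\<in>UNIV. \<Sum>j\<in>UNIV. v $ i * dx i (dx j h) z * v $ j)"
    by (rule sum.swap)
  finally show ?thesis .
qed

context local_metric
begin

text \<open>The equation $\partial_t u = \Delta u - |\nabla u|^2$ is the heat equation for $F = e^{-u}$ divided by
  $-F$; the third statement is its spatial half.\<close>
lemma
  fixes F defines "u \<equiv> \<lambda>z. - ln (F z)"
  assumes F: "smooth_on S F" and pos: "\<And>z. z \<in> S \<Longrightarrow> 0 < F z"
  shows smooth_neg_log: "smooth_on S u"
    and dirderiv_neg_log: "\<And>z v. z \<in> S \<Longrightarrow> F z * dirderiv v u z = - dirderiv v F z"
    and lap_neg_log: "\<And>z. z \<in> S \<Longrightarrow> lap u z - grad_sq u z = - (lap F z / F z)"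
proof -
  have ln: "smooth_on S (\<lambda>x. ln (F x))"
    by (intro smooth_on_ln open_S F pos)
  show u: "smooth_on S u"
    unfolding u_def by (intro smooth_on_minus ln open_S)
  show d: "F z * dirderiv v u z = - dirderiv v F z" if z: "z \<in> S" for z v
  proof -
    have "dirderiv v (\<lambda>x. ln (F x)) z = dirderiv v F z / F z"
      by (rule dirderiv_ln[OF open_S F _ z]) (rule pos)
    then show ?thesis
      unfolding u_def dirderiv_minus[OF open_S z ln] using pos[OF z] by simp
  qed
  show "lap u z - grad_sq u z = - (lap F z / F z)" if z: "z \<in> S" for z
  proof -
    (* The logarithm is differentiated through F u_j = - F_j, which avoids the quotient rule. *)
    have second: "F z * dx i (dx j u) z = - dx i (dx j F) z - dx i F z * dx j u z" for i j
    proof -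
      have "dx i (\<lambda>y. F y * dx j u y) z = dx i (\<lambda>y. - dx j F y) z"
        by (rule dirderiv_cong[OF open_S z d])
      moreover have "dx i (\<lambda>y. F y * dx j u y) z = dx i F z * dx j u z + F z * dx i (dx j u) z"
        by (intro dirderiv_mult[OF open_S z] smooth_rules F u)
      moreover have "dx i (\<lambda>y. - dx j F y) z = - dx i (dx j F) z"
        by (intro dirderiv_minus[OF open_S z] smooth_rules F)
      ultimately show ?thesis by simp
    qed
    have "F z * hess u i j z = F z * (dx i u z * dx j u z) - hess F i j z" for i j
    proof -
      have "F z * hess u i j z = F z * dx i (dx j u) z - (\<Sum>k\<in>UNIV. christof k i j z * (F z * dx k u z))"
        unfolding hess_def by (simp add: right_diff_distrib sum_distrib_left mult.left_commute)
      also have "\<dots> = - dx i (dx j F) z + (F z * dx i u z) * dx j u z + (\<Sum>k\<in>UNIV. christof k i j z * dx k F z)"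
        unfolding second d[OF z] by (simp add: sum_negf)
      finally show ?thesis unfolding hess_def by (simp add: mult.assoc)
    qed
    then have "(\<Sum>i\<in>UNIV. \<Sum>j\<in>UNIV. B i j z * (F z * hess u i j z))
        = (\<Sum>i\<in>UNIV. \<Sum>j\<in>UNIV. B i j z * (F z * (dx i u z * dx j u z) - hess F i j z))"
      by simp
    then have "F z * lap u z = F z * grad_sq u z - lap F z"
      unfolding lap_def grad_sq_def
      by (simp add: right_diff_distrib sum_subtractf sum_distrib_left mult_ac)
    then show ?thesis using pos[OF z] by (simp add: field_simps)
  qed
qed

end

locale local_ricci_flow = local_metric +
  assumes ricci_flow: "z \<in> S \<Longrightarrow> dt (G i j) z = - 2 * ric i j z"
begin

text \<open>Since $\partial_t g = -2\,\mathrm{Ric}$, the inverse metric evolves by $+2\,\mathrm{Ric}$ with raised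
  indices; this is the term that cancels the one in the Bochner formula.\<close>
lemma dt_grad_sq:
  assumes u: "smooth_on S u" and z: "z \<in> S"
  shows "dt (grad_sq u) z = 2 * (\<Sum>i\<in>UNIV. \<Sum>j\<in>UNIV. ric i j z * grad u i z * grad u j z)
    + 2 * (\<Sum>i\<in>UNIV. grad u i z * dx i (dt u) z)"
proof -
  have dtB: "dt (B i j) z = (\<Sum>b\<in>UNIV. \<Sum>c\<in>UNIV. 2 * B i b z * ric b c z * B c j z)" for i j
    unfolding dirderiv_B[OF z] ricci_flow[OF z] by (simp add: sum_negf mult_ac)
  have "dt (grad_sq u) z = (\<Sum>i\<in>UNIV. dt (\<lambda>x. \<Sum>j\<in>UNIV. B i j x * dx i u x * dx j u x) z)"
    unfolding grad_sq_def[abs_def] by (intro dirderiv_sum[OF open_S z] smooth_rules u)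
  also have "\<dots> = (\<Sum>i\<in>UNIV. \<Sum>j\<in>UNIV. dt (\<lambda>x. B i j x * dx i u x * dx j u x) z)"
    by (intro sum.cong refl dirderiv_sum[OF open_S z] smooth_rules u)
  also have "\<dots> = (\<Sum>i\<in>UNIV. \<Sum>j\<in>UNIV. (dt (B i j) z * dx i u z + B i j z * dt (dx i u) z) * dx j u z
      + B i j z * dx i u z * dt (dx j u) z)"
    by (intro sum.cong refl, subst dirderiv_mult[OF open_S z], (intro smooth_rules u)+, 
        subst dirderiv_mult[OF open_S z], (intro smooth_rules u)+, rule refl)
  also have "\<dots> = (\<Sum>i\<in>UNIV. \<Sum>j\<in>UNIV. dt (B i j) z * dx i u z * dx j u z)
      + ((\<Sum>i\<in>UNIV. \<Sum>j\<in>UNIV. B i j z * dx i (dt u) z * dx j u z) + (\<Sum>i\<in>UNIV. \<Sum>j\<in>UNIV. B i j z * dx i u z * dx j (dt u) z))"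
    by (simp add: sum.distrib algebra_simps dirderiv_commute[OF open_S u z, of "(1, 0)"])
  also have "(\<Sum>i\<in>UNIV. \<Sum>j\<in>UNIV. B i j z * dx i u z * dx j (dt u) z) = (\<Sum>j\<in>UNIV. \<Sum>i\<in>UNIV. B i j z * dx i u z * dx j (dt u) z)"
    by (rule sum.swap)
  also have "\<dots> = (\<Sum>i\<in>UNIV. grad u i z * dx i (dt u) z)"
    unfolding grad_def by (simp add: sum_distrib_left sum_distrib_right B_sym[OF z] mult_ac)
  also have "(\<Sum>i\<in>UNIV. \<Sum>j\<in>UNIV. B i j z * dx i (dt u) z * dx j u z) = (\<Sum>i\<in>UNIV. grad u i z * dx i (dt u) z)"
    unfolding grad_def by (simp add: sum_distrib_left mult_ac)
  also have "(\<Sum>i\<in>UNIV. \<Sum>j\<in>UNIV. dt (B i j) z * dx i u z * dx j u z)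
      = (\<Sum>i\<in>UNIV. \<Sum>j\<in>UNIV. \<Sum>b\<in>UNIV. \<Sum>c\<in>UNIV. 2 * (ric b c z * (B b i z * dx i u z) * (B c j z * dx j u z)))"
    unfolding dtB by (simp add: sum_distrib_left sum_distrib_right mult_ac B_sym[OF z])
  also have "\<dots> = (\<Sum>b\<in>UNIV. \<Sum>i\<in>UNIV. \<Sum>j\<in>UNIV. \<Sum>c\<in>UNIV. 2 * (ric b c z * (B b i z * dx i u z) * (B c j z * dx j u z)))"
    by (rule sum3_rotate)
  also have "\<dots> = (\<Sum>b\<in>UNIV. \<Sum>c\<in>UNIV. \<Sum>i\<in>UNIV. \<Sum>j\<in>UNIV. 2 * (ric b c z * (B b i z * dx i u z) * (B c j z * dx j u z)))"
    by (intro sum.cong refl sum3_rotate)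
  also have "\<dots> = 2 * (\<Sum>b\<in>UNIV. \<Sum>c\<in>UNIV. ric b c z * grad u b z * grad u c z)"
    unfolding grad_def mult.assoc sum_product by (simp add: sum_distrib_left mult.assoc)
  finally show ?thesis by simp
qed

lemma dt_grad_sq_log_heat:
  assumes u: "smooth_on S u" and z: "z \<in> S"
    and heat: "\<And>y. y \<in> S \<Longrightarrow> dt u y = lap u y - grad_sq u y"
  shows "dt (grad_sq u) z = lap (grad_sq u) z - 2 * (\<Sum>i\<in>UNIV. grad u i z * dx i (grad_sq u) z)
    - 2 * (\<Sum>i\<in>UNIV. \<Sum>l\<in>UNIV. cov_grad u l i z * cov_grad u i l z)"
proof -
  have "dx i (dt u) z = dx i (lap u) z - dx i (grad_sq u) z" for i
  proof -
    have "dx i (dt u) z = dx i (\<lambda>y. lap u y - grad_sq u y) z"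
      by (rule dirderiv_cong[OF open_S z heat])
    also have "\<dots> = dx i (lap u) z - dx i (grad_sq u) z"
      by (intro dirderiv_diff[OF open_S z] smooth_lap smooth_grad_sq u)
    finally show ?thesis .
  qed
  then show ?thesis
    unfolding dt_grad_sq[OF u z] bochner[OF u z]
    by (simp add: right_diff_distrib sum_subtractf)
qed

text \<open>The heart of the proof.  Criticality of \<open>W\<close> turns the term $-2t\langle\nabla u,\nabla|\nabla u|^2\rangle$
  into $-2|\nabla u|^2$, which cancels the two copies of $|\nabla u|^2$ that come from differentiating the
  factor $t$ and from the equation for $u$.  What remains is
  $\Delta W - 2t|\nabla^2u|^2$, and both terms are nonpositive at a spatial maximum.\<close>
lemma dt_nonpos_at_spatial_max:
  fixes u defines "W \<equiv> \<lambda>z. fst z * grad_sq u z - u z"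
  assumes u: "smooth_on S u" and z: "z \<in> S" and t: "0 \<le> fst z"
    and heat: "\<And>y. y \<in> S \<Longrightarrow> dt u y = lap u y - grad_sq u y"
    and max: "\<And>y. y \<in> S \<Longrightarrow> fst y = fst z \<Longrightarrow> W y \<le> W z"
  shows "dt W z \<le> 0"
proof -
  have fst: "smooth_on S fst"
    by (intro smooth_on_bounded_linear open_S bounded_linear_fst)
  have dfst: "dirderiv v fst y = fst v" for v y :: "real \<times> (real^'n)"
    by (intro dirderiv_eqI bounded_linear_imp_has_derivative bounded_linear_fst)
  have W: "smooth_on S W"
    unfolding W_def by (intro smooth_rules fst smooth_grad_sq u)
  have dW: "dirderiv v W y = fst v * grad_sq u y + fst y * dirderiv v (grad_sq u) y - dirderiv v u y" if "y \<in> S" for v y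
    unfolding W_def dirderiv_diff[OF open_S that smooth_on_mult[OF open_S fst smooth_grad_sq[OF u]] u]
      dirderiv_mult[OF open_S that fst smooth_grad_sq[OF u]] dfst by simp
  have ddW: "dx i (dx j W) z = fst z * dx i (dx j (grad_sq u)) z - dx i (dx j u) z" for i j
  proof -
    have "dx i (dx j W) z = dx i (\<lambda>y. fst y * dx j (grad_sq u) y - dx j u y) z"
      by (rule dirderiv_cong[OF open_S z]) (simp add: dW)
    also have "\<dots> = dx i (\<lambda>y. fst y * dx j (grad_sq u) y) z - dx i (dx j u) z"
      by (intro dirderiv_diff[OF open_S z] smooth_rules fst smooth_grad_sq u)
    also have "dx i (\<lambda>y. fst y * dx j (grad_sq u) y) z = fst z * dx i (dx j (grad_sq u)) z"
      unfolding dirderiv_mult[OF open_S z fst smooth_on_dirderiv[OF open_S smooth_grad_sq[OF u]]] dfst by simp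
    finally show ?thesis .
  qed
  have max': "W (z + s *\<^sub>R (0, v)) \<le> W z" if "z + s *\<^sub>R (0, v) \<in> S" for s v
    using max[OF that] by simp
  have crit: "dx i W z = 0" for i
    by (rule dirderiv_local_max(1)[OF open_S W z max'])
  then have eq: "fst z * dx i (grad_sq u) z = dx i u z" for i
    using dW[OF z, of "(0, axis i 1)"] by simp
  have "(\<Sum>i\<in>UNIV. \<Sum>j\<in>UNIV. v i * dx i (dx j W) z * v j) \<le> 0" for v
  proof -
    have "dirderiv (0, \<chi> i. v i) (dirderiv (0, \<chi> i. v i) W) z \<le> 0"
      by (rule dirderiv_local_max(2)[OF open_S W z max'])
    then show ?thesis
      unfolding dirderiv_spatial_twice[OF open_S W z] by simp
  qed
  then have "(\<Sum>i\<in>UNIV. \<Sum>j\<in>UNIV. B i j z * dx i (dx j W) z) \<le> 0"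
    by (rule psd_trace_nonpos[OF B_sym[OF z] B_psd[OF z]])
  then have "lap W z \<le> 0"
    unfolding lap_def hess_def crit by simp
  moreover have "hess W i j z = fst z * hess (grad_sq u) i j z - hess u i j z" for i j
    unfolding hess_def ddW dW[OF z] by (simp add: algebra_simps sum_subtractf sum_distrib_left)
  then have "lap W z = fst z * lap (grad_sq u) z - lap u z"
    unfolding lap_def
    by (simp add: right_diff_distrib sum_subtractf sum_distrib_left mult.left_commute)
  ultimately have lapW: "fst z * lap (grad_sq u) z - lap u z \<le> 0" by simp
  have h: "0 \<le> (\<Sum>i\<in>UNIV. \<Sum>l\<in>UNIV. cov_grad u l i z * cov_grad u i l z)"
    by (rule psd_trace_square_nonneg[OF B_sym[OF z] B_psd[OF z] hess_sym[OF z u] cov_grad_eq[OF z u]])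
  have cross: "fst z * (\<Sum>i\<in>UNIV. grad u i z * dx i (grad_sq u) z) = grad_sq u z"
    unfolding grad_sq_eq[OF z u] by (simp add: sum_distrib_left mult.left_commute[of "fst z"] eq)
  have evol: "dt (grad_sq u) z = lap (grad_sq u) z - 2 * (\<Sum>i\<in>UNIV. grad u i z * dx i (grad_sq u) z)
      - 2 * (\<Sum>i\<in>UNIV. \<Sum>l\<in>UNIV. cov_grad u l i z * cov_grad u i l z)"
    by (rule dt_grad_sq_log_heat[OF u z]) (rule heat)
  have "dt W z = grad_sq u z + fst z * dt (grad_sq u) z - dt u z"
    using dW[OF z] by simp
  also have "\<dots> = grad_sq u z + fst z * lap (grad_sq u) z
      - 2 * (fst z * (\<Sum>i\<in>UNIV. grad u i z * dx i (grad_sq u) z))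
      - 2 * fst z * (\<Sum>i\<in>UNIV. \<Sum>l\<in>UNIV. cov_grad u l i z * cov_grad u i l z) - (lap u z - grad_sq u z)"
    unfolding evol heat[OF z] by (simp add: algebra_simps)
  also have "\<dots> = (fst z * lap (grad_sq u) z - lap u z)
      - 2 * fst z * (\<Sum>i\<in>UNIV. \<Sum>l\<in>UNIV. cov_grad u l i z * cov_grad u i l z)"
    unfolding cross by simp
  also have "\<dots> \<le> 0"
    using lapW mult_nonneg_nonneg[OF t h] by (simp add: mult.assoc)
  finally show ?thesis .
qed

end


section \<open>Positive definite matrices and their inverses\<close>

definition pos_def :: "real^'n^'n \<Rightarrow> bool" where
  "pos_def A \<longleftrightarrow> transpose A = A \<and> (\<forall>v. v \<noteq> 0 \<longrightarrow> v \<bullet> (A *v v) > 0)"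

lemma matrix_inv_inverse:
  assumes "invertible A"
  shows "A ** matrix_inv A = mat 1" "matrix_inv A ** A = mat 1"
  using someI_ex[OF assms[unfolded invertible_def]] by (auto simp: matrix_inv_def)

lemma pos_def_invertible:
  fixes A :: "real^'n^'n"
  assumes "pos_def A"
  shows "invertible A"
proof -
  have "x = 0" if "A *v x = 0" for x
    using assms that unfolding pos_def_def by (metis inner_zero_right less_irrefl)
  then show ?thesis
    unfolding invertible_left_inverse matrix_left_invertible_ker by blast
qed

lemma pos_def_inv_apply:
  fixes A :: "real^'n^'n"
  assumes "pos_def A"
  shows "A *v (matrix_inv A *v x) = x" "matrix_inv A *v (A *v x) = x"
  using matrix_inv_inverse[OF pos_def_invertible[OF assms]]
  by (simp_all add: matrix_vector_mul_assoc)

lemma pos_def_dot: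
  fixes A :: "real^'n^'n"
  assumes "pos_def A"
  shows "x \<bullet> (A *v y) = (A *v x) \<bullet> y"
  using dot_lmul_matrix[of x A y] assms unfolding pos_def_def
  by (metis transpose_matrix_vector)

lemma pos_def_matrix_inv:
  fixes A :: "real^'n^'n"
  assumes A: "pos_def A"
  shows "pos_def (matrix_inv A)"
  unfolding pos_def_def
proof (intro conjI allI impI)
  have "(transpose (matrix_inv A) *v x) \<bullet> y = (matrix_inv A *v x) \<bullet> y" for x y
  proof -
    have "(transpose (matrix_inv A) *v x) \<bullet> y = x \<bullet> (matrix_inv A *v y)"
      by (simp add: dot_lmul_matrix)
    also have "\<dots> = (matrix_inv A *v x) \<bullet> y"
      using pos_def_dot[OF A, of "matrix_inv A *v x" "matrix_inv A *v y"]
      by (simp only: pos_def_inv_apply[OF A])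
    finally show ?thesis .
  qed
  then show "transpose (matrix_inv A) = matrix_inv A"
    unfolding matrix_eq using vector_eq_rdot by blast
next
  fix v :: "real^'n" assume "v \<noteq> 0"
  then have "matrix_inv A *v v \<noteq> 0"
    using pos_def_inv_apply(1)[OF A, of v] by auto
  then have "0 < (matrix_inv A *v v) \<bullet> (A *v (matrix_inv A *v v))"
    using A unfolding pos_def_def by blast
  then show "0 < v \<bullet> (matrix_inv A *v v)"
    by (simp only: pos_def_inv_apply[OF A] inner_commute)
qed

lemma pos_def_sym_nth: "pos_def A \<Longrightarrow> A $ i $ j = A $ j $ i"
  unfolding pos_def_def transpose_def by (metis vec_lambda_beta)

lemma inner_matrix_sum:
  fixes A :: "real^'n^'n"
  shows "v \<bullet> (A *v w) = (\<Sum>i\<in>UNIV. \<Sum>j\<in>UNIV. v $ i * A $ i $ j * w $ j)"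
  by (simp add: inner_vec_def matrix_vector_mult_def sum_distrib_left mult.assoc)

text \<open>Cramer's rule expresses the inverse by quotients of polynomials in the entries; smoothness and
  continuity of the inverse metric follow.\<close>
lemma matrix_inv_cramer:
  fixes A :: "real^'n^'n"
  assumes "invertible A"
  shows "matrix_inv A $ i $ j = det (\<chi> a b. if b = i then axis j 1 $ a else A $ a $ b) / det A"
proof -
  have "A *v (matrix_inv A *v axis j 1) = axis j 1"
    by (simp add: matrix_vector_mul_assoc matrix_inv_inverse[OF assms])
  then have "matrix_inv A *v axis j 1
      = (\<chi> k. det (\<chi> a b. if b = k then axis j 1 $ a else A $ a $ b) / det A)"
    using cramer[of A] assms invertible_det_nz by blast
  moreover have "(matrix_inv A *v axis j 1) $ i = matrix_inv A $ i $ j"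
    by (simp add: matrix_vector_mult_basis column_def)
  ultimately show ?thesis by simp
qed

lemma smooth_on_det:
  assumes S: "open S" and A: "\<And>i j. smooth_on S (\<lambda>z. A z $ i $ j)"
  shows "smooth_on S (\<lambda>z. det (A z :: real^'n^'n))"
  unfolding det_def by (intro smooth_on_sum smooth_on_mult smooth_on_prod smooth_on_const S A)

lemma continuous_on_det:
  assumes "\<And>i j. continuous_on S (\<lambda>z. A z $ i $ j)"
  shows "continuous_on S (\<lambda>z. det (A z :: real^'n^'n))"
  unfolding det_def by (intro continuous_intros assms)

lemma smooth_on_matrix_inv:
  fixes A :: "'a::euclidean_space \<Rightarrow> real^'n^'n"
  assumes S: "open S" and A: "\<And>i j. smooth_on S (\<lambda>z. A z $ i $ j)"
    and inv: "\<And>z. z \<in> S \<Longrightarrow> invertible (A z)"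
  shows "smooth_on S (\<lambda>z. matrix_inv (A z) $ i $ j)"
proof -
  have "smooth_on S (\<lambda>z. (\<chi> a b. if b = i then axis j 1 $ a else A z $ a $ b) $ k $ l)" for k l
    using A smooth_on_const[OF S] by (cases "l = i") simp_all
  then have "smooth_on S (\<lambda>z. det (\<chi> a b. if b = i then axis j 1 $ a else A z $ a $ b) / det (A z))"
    using inv by (intro smooth_on_divide smooth_on_det S A) (auto simp: invertible_det_nz)
  then show ?thesis
    by (subst smooth_on_cong) (auto simp: matrix_inv_cramer inv)
qed

lemma continuous_on_matrix_inv:
  fixes A :: "'a::topological_space \<Rightarrow> real^'n^'n"
  assumes A: "\<And>i j. continuous_on S (\<lambda>z. A z $ i $ j)"
    and inv: "\<And>z. z \<in> S \<Longrightarrow> invertible (A z)"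
  shows "continuous_on S (\<lambda>z. matrix_inv (A z) $ i $ j)"
proof -
  have "continuous_on S (\<lambda>z. (\<chi> a b. if b = i then axis j 1 $ a else A z $ a $ b) $ k $ l)" for k l
    using A by (cases "l = i") auto
  then have "continuous_on S (\<lambda>z. det (\<chi> a b. if b = i then axis j 1 $ a else A z $ a $ b) / det (A z))"
    using inv by (intro continuous_intros continuous_on_det A) (auto simp: invertible_det_nz)
  then show ?thesis
    by (subst continuous_on_cong[OF refl]) (auto simp: matrix_inv_cramer inv)
qed

lemma frechet_derivative_linear_comp:
  assumes l: "bounded_linear l" and h: "h differentiable (at x)"
  shows "frechet_derivative (\<lambda>x. l (h x)) (at x) v = l (frechet_derivative h (at x) v)"
  using frechet_derivative_at[OF bounded_linear.has_derivative[OF l h[unfolded frechet_derivative_works]]]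
  by metis

lemma Ck_on_linear_comp:
  assumes S: "open S" and l: "bounded_linear l"
  shows "Ck_on k S h \<Longrightarrow> Ck_on k S (\<lambda>x. l (h x))"
proof (induction k arbitrary: h)
  case 0
  then show ?case using bounded_linear.continuous_on[OF l] by simp
next
  case (Suc k)
  have d: "h differentiable (at x)" if "x \<in> S" for x
    using Suc.prems that at_within_open[OF that S] unfolding Ck_on.simps differentiable_on_def by metis
  have "Ck_on k S (\<lambda>x. frechet_derivative (\<lambda>x. l (h x)) (at x within S) v)" for v
  proof (subst Ck_on_cong)
    show "frechet_derivative (\<lambda>x. l (h x)) (at x within S) v = l (frechet_derivative h (at x within S) v)"
      if "x \<in> S" for x
      unfolding at_within_open[OF that S] by (rule frechet_derivative_linear_comp[OF l d[OF that]])
    show "Ck_on k S (\<lambda>x. l (frechet_derivative h (at x within S) v))"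
      using Suc by auto
  qed
  moreover have "(\<lambda>x. l (h x)) differentiable_on S"
    using Suc.prems bounded_linear.has_derivative[OF l]
    unfolding Ck_on.simps differentiable_on_def differentiable_def by blast
  ultimately show ?case by simp
qed

lemma smooth_on_matrix_nth:
  assumes S: "open S" and h: "smooth_on S (h :: _ \<Rightarrow> real^'n^'n)"
  shows "smooth_on S (\<lambda>x. h x $ i $ j)"
proof -
  have "bounded_linear (\<lambda>A::real^'n^'n. A $ i $ j)"
    by (intro bounded_linear_compose[OF bounded_linear_vec_nth bounded_linear_vec_nth])
  then show ?thesis
    using h Ck_on_linear_comp[OF S, of "\<lambda>A. A $ i $ j"] unfolding smooth_on_def by blast
qed

section \<open>Charts and the norm of the gradient\<close>

context
  fixes M :: "'m topology" and c :: "('m, 'n::finite) chart"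
  assumes c: "is_chart M c"
begin

lemma chart_dom_subset: "chart_dom c \<subseteq> topspace M"
  using c openin_subset unfolding is_chart_def by blast

lemma topspace_chart: "topspace (subtopology M (chart_dom c)) = chart_dom c"
  using chart_dom_subset by auto

lemma chart_inj: "inj_on (chart_map c) (chart_dom c)"
  using c homeomorphic_imp_injective_map topspace_chart unfolding is_chart_def by metis

lemma chart_inv_map: "p \<in> chart_dom c \<Longrightarrow> chart_inv c (chart_map c p) = p"
  unfolding chart_inv_def using chart_inj by simp

lemma chart_map_in: "p \<in> chart_dom c \<Longrightarrow> chart_map c p \<in> chart_image c"
  unfolding chart_image_def by simp

lemma chart_inv_in: "y \<in> chart_image c \<Longrightarrow> chart_inv c y \<in> chart_dom c"
  unfolding chart_inv_def chart_image_def by (simp add: inv_into_into)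

lemma chart_map_inv: "y \<in> chart_image c \<Longrightarrow> chart_map c (chart_inv c y) = y"
  unfolding chart_inv_def chart_image_def by (simp add: f_inv_into_f)

lemma open_chart_image: "open (chart_image c)"
  using c unfolding is_chart_def by blast

lemma open_chart_overlap:
  assumes d: "openin M U"
  shows "open (chart_map c ` (chart_dom c \<inter> U))"
proof -
  have "openin (subtopology M (chart_dom c)) (chart_dom c \<inter> U)"
    using d by (metis Int_commute openin_subtopology_Int)
  then have "openin (top_of_set (chart_image c)) (chart_map c ` (chart_dom c \<inter> U))"
    using c homeomorphic_imp_open_map unfolding is_chart_def open_map_def by blast
  then show ?thesis
    using open_chart_image openin_open_eq by blast
qed

end

text \<open>The squared norm of the gradient written with the inverse metric, $g^{ij}w_iw_j$, which involves
  no square root and is visibly smooth.\<close>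
definition grad_norm_sq ::
    "('m, 'n::finite) metric_field \<Rightarrow> ('m, 'n) chart \<Rightarrow> ('m \<Rightarrow> real) \<Rightarrow> 'm \<Rightarrow> real" where
  "grad_norm_sq \<gamma> c w p = (\<Sum>i\<in>UNIV. \<Sum>j\<in>UNIV. metric_inv \<gamma> c p $ i $ j * pderiv_chart c i w p * pderiv_chart c j w p)"

lemma riemannian_metric_pos_def:
  "riemannian_metric A \<gamma> \<Longrightarrow> c \<in> A \<Longrightarrow> p \<in> chart_dom c \<Longrightarrow> pos_def (\<gamma> c p)"
  unfolding riemannian_metric_def pos_def_def by blast

lemma grad_norm_sq_eq:
  "grad_norm_sq \<gamma> c w p = (\<chi> j. pderiv_chart c j w p) \<bullet> gradient \<gamma> c w p"
  unfolding grad_norm_sq_def gradient_def inner_matrix_sum by (simp add: mult_ac)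

lemma metric_norm_gradient_sq:
  assumes "pos_def (\<gamma> c p)"
  shows "(metric_norm \<gamma> c p (gradient \<gamma> c w p))\<^sup>2 = grad_norm_sq \<gamma> c w p"
proof -
  let ?X = "gradient \<gamma> c w p"
  have "0 \<le> ?X \<bullet> (\<gamma> c p *v ?X)"
    using assms unfolding pos_def_def by (cases "?X = 0") (auto intro: less_imp_le)
  then have "(metric_norm \<gamma> c p ?X)\<^sup>2 = ?X \<bullet> (\<gamma> c p *v ?X)"
    unfolding metric_norm_def by simp
  also have "\<gamma> c p *v ?X = (\<chi> j. pderiv_chart c j w p)"
    unfolding gradient_def metric_inv_def by (rule pos_def_inv_apply[OF assms])
  finally show ?thesis
    unfolding grad_norm_sq_eq by (simp add: inner_commute)
qed

text \<open>The chain rule: near the point, \<open>w\<close> in the coordinates of \<open>c\<close> is \<open>w\<close> in the coordinates of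
  \<open>d\<close> composed with the transition map.\<close>
lemma pderiv_chart_transition:
  fixes c d :: "('m, 'n::finite) chart"
  assumes at: "smooth_atlas M A" and c: "c \<in> A" and d: "d \<in> A"
    and p: "p \<in> chart_dom c" "p \<in> chart_dom d"
    and w: "(w \<circ> chart_inv d) differentiable (at (chart_map d p))"
  shows "(\<chi> i. pderiv_chart c i w p) = transpose (transition_jacobian c d p) *v (\<chi> i. pderiv_chart d i w p)"
proof -
  let ?\<phi> = "chart_map d \<circ> chart_inv c" and ?x = "chart_map c p" and ?J = "transition_jacobian c d p"
  let ?O = "chart_map c ` (chart_dom c \<inter> chart_dom d)"
  have ch: "is_chart M c" "is_chart M d" and sm: "smooth_on ?O ?\<phi>"
    using at c d unfolding smooth_atlas_def by auto
  have O: "open ?O" "?x \<in> ?O"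
    using open_chart_overlap[OF ch(1)] ch(2) p unfolding is_chart_def by auto
  have "Ck_on (Suc 0) ?O ?\<phi>" using sm unfolding smooth_on_def by blast
  then have "?\<phi> differentiable (at ?x)"
    using O(2) at_within_open[OF O(2,1)] unfolding Ck_on.simps differentiable_on_def by metis
  then have D\<phi>: "(?\<phi> has_derivative (\<lambda>v. ?J *v v)) (at ?x)"
    unfolding transition_jacobian_def jacobian_works .
  have \<phi>x: "?\<phi> ?x = chart_map d p"
    using chart_inv_map[OF ch(1)] p by simp
  let ?D = "frechet_derivative (w \<circ> chart_inv d) (at (chart_map d p))"
  have Dw: "((w \<circ> chart_inv d) has_derivative ?D) (at (?\<phi> ?x))"
    using w unfolding \<phi>x frechet_derivative_works .
  have "((\<lambda>y. (w \<circ> chart_inv d) (?\<phi> y)) has_derivative (\<lambda>v. ?D (?J *v v))) (at ?x)"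
    by (rule has_derivative_compose[OF D\<phi> Dw])
  then have "((w \<circ> chart_inv c) has_derivative (\<lambda>v. ?D (?J *v v))) (at ?x)"
  proof (rule has_derivative_transform_within_open[OF _ O])
    fix y assume "y \<in> ?O"
    then show "(w \<circ> chart_inv d) (?\<phi> y) = (w \<circ> chart_inv c) y"
      using chart_inv_map[OF ch(1)] chart_inv_map[OF ch(2)] by auto
  qed
  then have "pderiv_chart c i w p = ?D (?J *v axis i 1)" for i
    unfolding pderiv_chart_def using frechet_derivative_at by metis
  also have "?D (?J *v axis i 1) = (\<Sum>k\<in>UNIV. ?J $ k $ i * pderiv_chart d k w p)" for i
  proof -
    have lin: "linear ?D" using w by (rule linear_frechet_derivative)
    have "?J *v axis i 1 = (\<Sum>k\<in>UNIV. (?J $ k $ i) *\<^sub>R axis k 1)"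
      using basis_expansion[of "column i ?J"]
      by (simp add: matrix_vector_mult_basis scalar_mult_eq_scaleR column_def)
    then show ?thesis
      unfolding pderiv_chart_def by (simp add: linear_sum[OF lin] linear_cmul[OF lin])
  qed
  finally show ?thesis
    by (simp add: vec_eq_iff vector_matrix_mult_def mult.commute)
qed

text \<open>With Jacobian \<open>J\<close> the metric is $J^TGJ$ and the differential $J^Tb$, so the gradient is mapped by \<open>J\<close>
  to the gradient in the other chart, and its pairing with the differential is unchanged.\<close>
lemma grad_norm_sq_chart_independent:
  fixes c d :: "('m, 'n::finite) chart"
  assumes at: "smooth_atlas M A" and \<gamma>: "riemannian_metric A \<gamma>" and c: "c \<in> A" and d: "d \<in> A"
    and p: "p \<in> chart_dom c" "p \<in> chart_dom d"
    and w: "(w \<circ> chart_inv d) differentiable (at (chart_map d p))"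
  shows "grad_norm_sq \<gamma> c w p = grad_norm_sq \<gamma> d w p"
proof -
  define J where "J = transition_jacobian c d p"
  define a where "a = (\<chi> i. pderiv_chart c i w p)"
  define b where "b = (\<chi> i. pderiv_chart d i w p)"
  define X where "X = gradient \<gamma> c w p"
  have ab: "a = transpose J *v b"
    unfolding a_def b_def J_def by (rule pderiv_chart_transition[OF at c d p w])
  have pc: "pos_def (\<gamma> c p)" and pd: "pos_def (\<gamma> d p)"
    using riemannian_metric_pos_def \<gamma> c d p by metis+
  have tr: "\<gamma> c p = transpose J ** \<gamma> d p ** J"
    using \<gamma> c d p unfolding riemannian_metric_def J_def by blast
  have "v = 0" if "J *v v = 0" for v
  proof -
    have "\<gamma> c p *v v = 0"
      unfolding tr by (simp add: matrix_vector_mul_assoc[symmetric] that)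
    then show ?thesis using pc unfolding pos_def_def by (metis inner_zero_right less_irrefl)
  qed
  then have "invertible J"
    unfolding invertible_left_inverse matrix_left_invertible_ker by blast
  then obtain K where K: "J ** K = mat 1" unfolding invertible_def by blast
  have inj: "x = y" if "transpose J *v x = transpose J *v y" for x y :: "real^'n"
  proof -
    have "transpose K *v (transpose J *v x) = x" for x :: "real^'n"
      unfolding matrix_vector_mul_assoc matrix_transpose_mul[symmetric] K by (simp add: transpose_mat)
    then show ?thesis using that by metis
  qed
  have "transpose J *v (\<gamma> d p *v (J *v X)) = \<gamma> c p *v X"
    unfolding tr by (simp only: matrix_vector_mul_assoc matrix_mul_assoc)
  also have "\<dots> = transpose J *v b"
    unfolding X_def gradient_def metric_inv_def pos_def_inv_apply(1)[OF pc]
    using ab unfolding a_def .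
  finally have "\<gamma> d p *v (J *v X) = b" by (rule inj)
  then have JX: "J *v X = gradient \<gamma> d w p"
    unfolding gradient_def metric_inv_def b_def[symmetric] using pos_def_inv_apply(2)[OF pd] by metis
  have "grad_norm_sq \<gamma> c w p = (transpose J *v b) \<bullet> X"
    unfolding grad_norm_sq_eq a_def[symmetric] X_def[symmetric] ab ..
  also have "\<dots> = b \<bullet> (J *v X)"
    by (simp add: dot_lmul_matrix)
  finally show ?thesis
    unfolding grad_norm_sq_eq b_def[symmetric] JX .
qed


section \<open>The flow in the space-time coordinates of a chart\<close>

definition in_chart :: "('m, 'n::finite) chart \<Rightarrow> (real \<Rightarrow> 'm \<Rightarrow> 'a) \<Rightarrow> real \<times> (real^'n) \<Rightarrow> 'a" where
  "in_chart c h z = h (fst z) (chart_inv c (snd z))"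

text \<open>Coordinate derivatives at a fixed time are the restrictions to spatial directions of a derivative in
  space-time.  The latter is taken within \<open>I \<times> chart_image c\<close> because the initial time is a
  boundary point of \<open>I\<close>.\<close>
lemma pderiv_chart_slice:
  fixes c :: "('m, 'n::finite) chart"
  assumes c: "is_chart M c" and p: "p \<in> chart_dom c" and t: "t \<in> I"
    and D: "(in_chart c h has_derivative D) (at (t, chart_map c p) within I \<times> chart_image c)"
  shows "(h t \<circ> chart_inv c) differentiable (at (chart_map c p))"
    and "pderiv_chart c i (h t) p = D (0, axis i 1)"
proof -
  let ?x = "chart_map c p" and ?V = "chart_image c"
  have "((\<lambda>y. (t, y)) has_derivative (\<lambda>v. (0, v))) (at ?x within ?V)"
    by (intro has_derivative_Pair has_derivative_const has_derivative_ident)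
  moreover have "(in_chart c h has_derivative D) (at (t, ?x) within (\<lambda>y. (t, y)) ` ?V)"
    using D t by (elim has_derivative_subset) auto
  ultimately have "((\<lambda>y. in_chart c h (t, y)) has_derivative (\<lambda>v. D (0, v))) (at ?x within ?V)"
    by (rule has_derivative_in_compose)
  then have *: "((h t \<circ> chart_inv c) has_derivative (\<lambda>v. D (0, v))) (at ?x)"
    unfolding at_within_open[OF chart_map_in[OF c p] open_chart_image[OF c]]
    by (simp add: in_chart_def o_def)
  then show "(h t \<circ> chart_inv c) differentiable (at ?x)"
    by (rule differentiableI)
  show "pderiv_chart c i (h t) p = D (0, axis i 1)"
    unfolding pderiv_chart_def using frechet_derivative_at[OF *] by metis
qed

lemma pderiv_chart_neg_ln:
  fixes c :: "('m, 'n::finite) chart"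
  assumes c: "is_chart M c" and p: "p \<in> chart_dom c" and pos: "0 < w p"
    and w: "(w \<circ> chart_inv c) differentiable (at (chart_map c p))"
  shows "((\<lambda>q. - ln (w q)) \<circ> chart_inv c) differentiable (at (chart_map c p))"
    and "pderiv_chart c i (\<lambda>q. - ln (w q)) p = - pderiv_chart c i w p / w p"
proof -
  let ?x = "chart_map c p" and ?D = "frechet_derivative (w \<circ> chart_inv c) (at (chart_map c p))"
  have x: "(w \<circ> chart_inv c) ?x = w p"
    using chart_inv_map[OF c p] by simp
  have "((\<lambda>y. - ln ((w \<circ> chart_inv c) y)) has_derivative (\<lambda>v. - (?D v * inverse (w p)))) (at ?x)"
    using has_derivative_minus[OF has_derivative_ln[OF _ w[unfolded frechet_derivative_works]]] pos
    unfolding x by simp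
  then have *: "((\<lambda>q. - ln (w q)) \<circ> chart_inv c has_derivative (\<lambda>v. - (?D v * inverse (w p)))) (at ?x)"
    by (simp add: o_def)
  then show "((\<lambda>q. - ln (w q)) \<circ> chart_inv c) differentiable (at ?x)"
    by (rule differentiableI)
  show "pderiv_chart c i (\<lambda>q. - ln (w q)) p = - pderiv_chart c i w p / w p"
    unfolding pderiv_chart_def frechet_derivative_at[OF *, symmetric]
    by (simp add: divide_inverse)
qed

locale ricci_heat_flow =
  fixes M :: "'m topology" and A :: "('m, 'n::finite) chart set" and T :: ereal
    and g :: "real \<Rightarrow> ('m, 'n) metric_field" and f :: "real \<Rightarrow> 'm \<Rightarrow> real"
  assumes manifold: "closed_manifold M A"
    and flow: "ricci_flow A T g"
    and heat: "heat_solution A T g f"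
    and f_range: "t \<in> time_interval T \<Longrightarrow> p \<in> topspace M \<Longrightarrow> 0 < f t p \<and> f t p < 1"
begin

text \<open>The time $0$ is left out, so that the domain is open and ordinary derivatives apply; continuity
  up to time $0$ is treated separately.\<close>
definition open_times :: "real set" where
  "open_times = {t. 0 < t \<and> ereal t < T}"

definition spacetime :: "('m, 'n) chart \<Rightarrow> (real \<times> (real^'n)) set" where
  "spacetime c = open_times \<times> chart_image c"

definition G where "G c i j = in_chart c (\<lambda>t p. g t c p $ i $ j)"
definition B where "B c i j = in_chart c (\<lambda>t p. metric_inv (g t) c p $ i $ j)"
definition u where "u t p = - ln (f t p)"

lemma atlas: "smooth_atlas M A" and compact: "compact_space M"
  using manifold unfolding closed_manifold_def smooth_manifold_def by auto

lemma chart: "c \<in> A \<Longrightarrow> is_chart M c"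
  using atlas unfolding smooth_atlas_def by blast

lemma open_times_open: "open open_times"
proof -
  have "open_times = {0<..} \<inter> {t. ereal t < T}" by (auto simp: open_times_def)
  moreover have "open {t. ereal t < T}"
    by (intro open_Collect_less continuous_intros)
  ultimately show ?thesis by (simp only: open_Int open_greaterThan)
qed

lemma open_times_subset: "open_times \<subseteq> time_interval T"
  by (auto simp: open_times_def time_interval_def)

lemma spacetime_open: "c \<in> A \<Longrightarrow> open (spacetime c)"
  unfolding spacetime_def by (intro open_Times open_times_open open_chart_image[OF chart])

lemma spacetimeD:
  assumes "c \<in> A" "z \<in> spacetime c"
  shows "fst z \<in> open_times" "fst z \<in> time_interval T" "chart_inv c (snd z) \<in> chart_dom c"
    "chart_map c (chart_inv c (snd z)) = snd z"
  using assms chart_inv_in[OF chart, of c "snd z"] chart_map_inv[OF chart, of c "snd z"] open_times_subset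
  unfolding spacetime_def mem_Times_iff by blast+

lemma metric: "t \<in> time_interval T \<Longrightarrow> riemannian_metric A (g t)"
  using flow unfolding ricci_flow_def by simp

lemma metric_pos_def: "t \<in> time_interval T \<Longrightarrow> c \<in> A \<Longrightarrow> p \<in> chart_dom c \<Longrightarrow> pos_def (g t c p)"
  by (rule riemannian_metric_pos_def[OF metric])

lemma smooth_g: "c \<in> A \<Longrightarrow> smooth_on (time_interval T \<times> chart_image c) (in_chart c (\<lambda>t. g t c))"
  using flow unfolding ricci_flow_def in_chart_def[abs_def] by (simp add: case_prod_beta')

lemma smooth_f: "c \<in> A \<Longrightarrow> smooth_on (time_interval T \<times> chart_image c) (in_chart c f)"
  using heat unfolding heat_solution_def in_chart_def[abs_def] by (simp add: case_prod_beta')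

lemma smooth_spacetime:
  "c \<in> A \<Longrightarrow> smooth_on (time_interval T \<times> chart_image c) h \<Longrightarrow> smooth_on (spacetime c) h"
  by (erule smooth_on_subset[OF _ spacetime_open])
     (simp_all add: spacetime_def Sigma_mono open_times_subset)

context
  fixes c assumes cA: "c \<in> A"
begin

lemma dx_in_chart:
  assumes k: "smooth_on (spacetime c) k" "\<And>y. y \<in> spacetime c \<Longrightarrow> in_chart c h y = k y" and z: "z \<in> spacetime c"
  shows "pderiv_chart c i (h (fst z)) (chart_inv c (snd z)) = dx i k z"
proof -
  note zD = spacetimeD[OF cA z]
  have "(k has_derivative (\<lambda>v. dirderiv v k z)) (at z)"
    by (intro has_derivative_dirderiv smooth_on_differentiable[OF spacetime_open[OF cA] k(1) z])
  then have "(in_chart c h has_derivative (\<lambda>v. dirderiv v k z)) (at z)"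
    by (rule has_derivative_transform_within_open[OF _ spacetime_open[OF cA] z]) (simp add: k(2))
  then have "(in_chart c h has_derivative (\<lambda>v. dirderiv v k z))
      (at (fst z, chart_map c (chart_inv c (snd z))) within time_interval T \<times> chart_image c)"
    unfolding zD(4) by (simp add: has_derivative_at_withinI)
  from pderiv_chart_slice(2)[OF chart[OF cA] zD(3,2) this] show ?thesis .
qed

lemma dt_in_chart:
  assumes k: "smooth_on (spacetime c) k" "\<And>y. y \<in> spacetime c \<Longrightarrow> in_chart c h y = k y" and z: "z \<in> spacetime c"
    and r: "((\<lambda>s. h s (chart_inv c (snd z))) has_real_derivative r) (at (fst z) within time_interval T)"
  shows "dt k z = r"
proof -
  note zD = spacetimeD[OF cA z]
  have "at (fst z) within time_interval T = at (fst z)"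
    by (rule at_within_open_subset[OF zD(1) open_times_open open_times_subset])
  then have "((\<lambda>s. h s (chart_inv c (snd z))) has_real_derivative r) (at (fst z))"
    using r by simp
  then have "((\<lambda>s. k ((0, snd z) + s *\<^sub>R (1, 0))) has_real_derivative r) (at (fst z))"
  proof (rule has_field_derivative_transform_within_open[OF _ open_times_open zD(1)])
    fix s assume "s \<in> open_times"
    then have "(s, snd z) \<in> spacetime c" using z by (auto simp: spacetime_def)
    from k(2)[OF this] show "h s (chart_inv c (snd z)) = k ((0, snd z) + s *\<^sub>R (1, 0))"
      by (simp add: in_chart_def)
  qed
  moreover have "((\<lambda>s. k ((0, snd z) + s *\<^sub>R (1, 0))) has_real_derivative
      dt k ((0, snd z) + fst z *\<^sub>R (1, 0))) (at (fst z))"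
    using z by (intro line_derivative[OF spacetime_open[OF cA] k(1)]) simp
  ultimately show ?thesis using DERIV_unique by fastforce
qed

lemma smooth_G: "smooth_on (spacetime c) (G c i j)"
proof -
  have "G c i j = (\<lambda>z. in_chart c (\<lambda>t. g t c) z $ i $ j)"
    by (simp add: G_def in_chart_def fun_eq_iff)
  then show ?thesis
    using smooth_on_matrix_nth[OF spacetime_open[OF cA] smooth_spacetime[OF cA smooth_g[OF cA]]] by simp
qed

lemma local_metric_chart: "local_metric (spacetime c) (G c) (B c)"
proof
  note op = spacetime_open[OF cA]
  show "open (spacetime c)" by (rule op)
  show "smooth_on (spacetime c) (G c i j)" for i j by (rule smooth_G)
  have pd: "pos_def (in_chart c (\<lambda>t. g t c) z)" if "z \<in> spacetime c" for z
    unfolding in_chart_def using spacetimeD[OF cA that] metric_pos_def cA by blast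
  have Geq: "G c i j z = in_chart c (\<lambda>t. g t c) z $ i $ j" for i j z
    by (simp add: G_def in_chart_def)
  have Beq: "B c i j z = matrix_inv (in_chart c (\<lambda>t. g t c) z) $ i $ j" for i j z
    by (simp add: B_def in_chart_def metric_inv_def)
  show "smooth_on (spacetime c) (B c i j)" for i j
    unfolding Beq[abs_def]
    by (intro smooth_on_matrix_inv op pos_def_invertible pd smooth_G[unfolded Geq[abs_def]])
  fix z assume z: "z \<in> spacetime c"
  show "G c i j z = G c j i z" for i j
    unfolding Geq by (rule pos_def_sym_nth[OF pd[OF z]])
  show "B c i j z = B c j i z" for i j
    unfolding Beq by (rule pos_def_sym_nth[OF pos_def_matrix_inv[OF pd[OF z]]])
  show "(\<Sum>k\<in>UNIV. B c i k z * G c k j z) = (if i = j then 1 else 0)" for i j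
  proof -
    have "(\<Sum>k\<in>UNIV. B c i k z * G c k j z) = (matrix_inv (in_chart c (\<lambda>t. g t c) z) ** in_chart c (\<lambda>t. g t c) z) $ i $ j"
      unfolding Geq Beq matrix_matrix_mult_def by simp
    then show ?thesis
      unfolding matrix_inv_inverse(2)[OF pos_def_invertible[OF pd[OF z]]] by (simp add: mat_def)
  qed
  show "0 \<le> (\<Sum>i\<in>UNIV. \<Sum>j\<in>UNIV. v i * B c i j z * v j)" for v
  proof -
    have "0 \<le> (\<chi> i. v i) \<bullet> (matrix_inv (in_chart c (\<lambda>t. g t c) z) *v (\<chi> i. v i))"
      using pos_def_matrix_inv[OF pd[OF z]] unfolding pos_def_def
      by (metis inner_zero_left less_imp_le order_refl)
    then show ?thesis unfolding inner_matrix_sum Beq by simp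
  qed
qed

interpretation L: local_metric "spacetime c" "G c" "B c"
  by (rule local_metric_chart)

lemma christoffel_chart:
  assumes z: "z \<in> spacetime c"
  shows "christoffel (g (fst z)) c k i j (chart_inv c (snd z)) = L.christof k i j z"
proof -
  have "pderiv_chart c a (\<lambda>q. g (fst z) c q $ b $ d) (chart_inv c (snd z)) = dx a (G c b d) z" for a b d
    by (rule dx_in_chart[OF smooth_G _ z, where h = "\<lambda>t q. g t c q $ b $ d"]) (simp add: G_def)
  then show ?thesis
    unfolding christoffel_def L.christof_def by (simp add: B_def in_chart_def)
qed

lemma ricci_chart:
  assumes z: "z \<in> spacetime c"
  shows "ricci (g (fst z)) c i j (chart_inv c (snd z)) = L.ric i j z"
proof -
  have "pderiv_chart c a (christoffel (g (fst z)) c k b d) (chart_inv c (snd z)) = dx a (L.christof k b d) z" for a b d k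
    by (rule dx_in_chart[OF L.smooth_christof _ z, where h = "\<lambda>t. christoffel (g t) c k b d"])
       (simp add: in_chart_def christoffel_chart)
  then show ?thesis
    unfolding ricci_def riemann_curv_def L.ric_def using christoffel_chart[OF z] by simp
qed

lemma local_ricci_flow_chart: "local_ricci_flow (spacetime c) (G c) (B c)"
proof
  fix z i j assume z: "z \<in> spacetime c"
  show "dt (G c i j) z = - 2 * L.ric i j z"
  proof (rule dt_in_chart[OF smooth_G _ z])
    show "in_chart c (\<lambda>t p. g t c p $ i $ j) y = G c i j y" for y by (simp add: G_def)
    show "((\<lambda>s. g s c (chart_inv c (snd z)) $ i $ j) has_real_derivative - 2 * L.ric i j z)
        (at (fst z) within time_interval T)"
      using flow spacetimeD[OF cA z] cA unfolding ricci_flow_def ricci_chart[OF z, symmetric] by blast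
  qed
qed

context
  fixes h :: "real \<Rightarrow> 'm \<Rightarrow> real" and k
  assumes k: "smooth_on (spacetime c) k" "\<And>y. y \<in> spacetime c \<Longrightarrow> in_chart c h y = k y"
begin

lemma laplacian_chart:
  assumes z: "z \<in> spacetime c"
  shows "laplacian (g (fst z)) c (h (fst z)) (chart_inv c (snd z)) = L.lap k z"
proof -
  have 1: "pderiv_chart c a (h (fst y)) (chart_inv c (snd y)) = dx a k y" if "y \<in> spacetime c" for a y
    by (rule dx_in_chart[OF k that])
  have "pderiv_chart c a (pderiv_chart c b (h (fst z))) (chart_inv c (snd z)) = dx a (dx b k) z" for a b
    by (rule dx_in_chart[OF smooth_on_dirderiv[OF spacetime_open[OF cA] k(1)] _ z, where h = "\<lambda>t. pderiv_chart c b (h t)"])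
       (simp add: in_chart_def 1)
  then show ?thesis
    unfolding laplacian_def hessian_def L.lap_def L.hess_def
    using 1[OF z] christoffel_chart[OF z] by (simp add: B_def in_chart_def)
qed

lemma grad_norm_sq_chart:
  assumes z: "z \<in> spacetime c"
  shows "grad_norm_sq (g (fst z)) c (h (fst z)) (chart_inv c (snd z)) = L.grad_sq k z"
proof -
  have "pderiv_chart c a (h (fst z)) (chart_inv c (snd z)) = dx a k z" for a
    by (rule dx_in_chart[OF k z])
  then show ?thesis
    unfolding grad_norm_sq_def L.grad_sq_def by (simp add: B_def in_chart_def)
qed

end

lemma f_pos: "y \<in> spacetime c \<Longrightarrow> 0 < in_chart c f y"
  unfolding in_chart_def using spacetimeD[OF cA] f_range chart_dom_subset[OF chart[OF cA]] by blast

lemma smooth_f_in_chart: "smooth_on (spacetime c) (in_chart c f)"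
  by (rule smooth_spacetime[OF cA smooth_f[OF cA]])

lemma u_in_chart: "in_chart c u = (\<lambda>z. - ln (in_chart c f z))"
  by (simp add: in_chart_def u_def fun_eq_iff)

lemma smooth_u_in_chart: "smooth_on (spacetime c) (in_chart c u)"
  unfolding u_in_chart by (intro L.smooth_neg_log smooth_f_in_chart f_pos)

lemma dt_u:
  assumes z: "z \<in> spacetime c"
  shows "dt (in_chart c u) z = L.lap (in_chart c u) z - L.grad_sq (in_chart c u) z"
proof -
  have "dt (in_chart c f) z = L.lap (in_chart c f) z"
  proof (rule dt_in_chart[OF smooth_f_in_chart refl z])
    show "((\<lambda>s. f s (chart_inv c (snd z))) has_real_derivative L.lap (in_chart c f) z)
        (at (fst z) within time_interval T)"
      using heat spacetimeD[OF cA z] cA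
      unfolding heat_solution_def laplacian_chart[OF smooth_f_in_chart refl z, symmetric] by blast
  qed
  moreover have "in_chart c f z * dt (in_chart c u) z = - dt (in_chart c f) z"
    unfolding u_in_chart by (intro L.dirderiv_neg_log smooth_f_in_chart f_pos z)
  ultimately have "dt (in_chart c u) z = - (L.lap (in_chart c f) z / in_chart c f z)"
    using f_pos[OF z] by (simp add: field_simps)
  moreover have "L.lap (in_chart c u) z - L.grad_sq (in_chart c u) z = - (L.lap (in_chart c f) z / in_chart c f z)"
    unfolding u_in_chart by (intro L.lap_neg_log smooth_f_in_chart f_pos z)
  ultimately show ?thesis by simp
qed

end

end


context ricci_heat_flow
begin

section \<open>The maximum principle on a closed manifold\<close>

text \<open>Choosing a chart at every point makes \<open>W\<close> a function on \<open>M\<close>; its value does not depend on the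
  choice.\<close>
definition W :: "real \<Rightarrow> 'm \<Rightarrow> real" where
  "W t p = t * grad_norm_sq (g t) (SOME c. c \<in> A \<and> p \<in> chart_dom c) (u t) p - u t p"

lemma f_slice:
  assumes c: "c \<in> A" and p: "p \<in> chart_dom c" and t: "t \<in> time_interval T"
  shows "(f t \<circ> chart_inv c) differentiable (at (chart_map c p))"
    and "pderiv_chart c i (f t) p
      = frechet_derivative (in_chart c f) (at (t, chart_map c p) within time_interval T \<times> chart_image c) (0, axis i 1)"
proof -
  have "Ck_on (Suc 0) (time_interval T \<times> chart_image c) (in_chart c f)"
    using smooth_f[OF c] unfolding smooth_on_def by blast
  moreover have "(t, chart_map c p) \<in> time_interval T \<times> chart_image c"
    using t chart_map_in[OF chart[OF c] p] by simp
  ultimately have D: "(in_chart c f has_derivative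
      frechet_derivative (in_chart c f) (at (t, chart_map c p) within time_interval T \<times> chart_image c))
      (at (t, chart_map c p) within time_interval T \<times> chart_image c)"
    unfolding Ck_on.simps differentiable_on_def frechet_derivative_works by blast
  show "(f t \<circ> chart_inv c) differentiable (at (chart_map c p))"
    by (rule pderiv_chart_slice(1)[OF chart[OF c] p t D])
  show "pderiv_chart c i (f t) p
      = frechet_derivative (in_chart c f) (at (t, chart_map c p) within time_interval T \<times> chart_image c) (0, axis i 1)"
    by (rule pderiv_chart_slice(2)[OF chart[OF c] p t D])
qed

lemma f_pos_point: "c \<in> A \<Longrightarrow> p \<in> chart_dom c \<Longrightarrow> t \<in> time_interval T \<Longrightarrow> 0 < f t p"
  using f_range chart_dom_subset[OF chart] by blast

lemma u_slice:
  assumes c: "c \<in> A" and p: "p \<in> chart_dom c" and t: "t \<in> time_interval T"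
  shows "(u t \<circ> chart_inv c) differentiable (at (chart_map c p))"
    and "pderiv_chart c i (u t) p = - pderiv_chart c i (f t) p / f t p"
  unfolding u_def[abs_def]
  by (rule pderiv_chart_neg_ln[where w = "f t", OF chart[OF c] p f_pos_point[OF c p t] f_slice(1)[OF c p t]])+

lemma grad_norm_sq_u:
  assumes c: "c \<in> A" and p: "p \<in> chart_dom c" and t: "t \<in> time_interval T"
  shows "grad_norm_sq (g t) c (u t) p = grad_norm_sq (g t) c (f t) p / (f t p)\<^sup>2"
  unfolding grad_norm_sq_def u_slice(2)[OF c p t]
  by (simp add: sum_divide_distrib power2_eq_square)

lemma W_chart:
  assumes c: "c \<in> A" and p: "p \<in> chart_dom c" and t: "t \<in> time_interval T"
  shows "W t p = t * grad_norm_sq (g t) c (u t) p - u t p"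
proof -
  define d where "d = (SOME c. c \<in> A \<and> p \<in> chart_dom c)"
  have "d \<in> A \<and> p \<in> chart_dom d"
    unfolding d_def using c p by (intro someI[of "\<lambda>c. c \<in> A \<and> p \<in> chart_dom c"]) simp
  then have d: "d \<in> A" "p \<in> chart_dom d" by auto
  show ?thesis
    unfolding W_def d_def[symmetric]
    by (simp only: grad_norm_sq_chart_independent[OF atlas metric[OF t] d(1) c d(2) p u_slice(1)[OF c p t]])
qed

text \<open>Continuity includes the initial time, where no ordinary time derivative is available: the
  coordinate derivatives of \<open>f\<close> are derivatives within the half-open cylinder, which are
  continuous there by smoothness up to the boundary.\<close>
lemma continuous_W_in_chart:
  assumes c: "c \<in> A"
  shows "continuous_on (time_interval T \<times> chart_image c) (in_chart c W)"
proof -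
  let ?S = "time_interval T \<times> chart_image c"
  define D where "D i z = frechet_derivative (in_chart c f) (at z within ?S) (0, axis i 1)" for i z
  have D: "continuous_on ?S (D i)" for i
  proof -
    have "Ck_on (Suc 0) ?S (in_chart c f)"
      using smooth_f[OF c] unfolding smooth_on_def by blast
    then show ?thesis unfolding D_def[abs_def] by simp
  qed
  have F: "continuous_on ?S (in_chart c f)"
    by (rule smooth_on_continuous[OF smooth_f[OF c]])
  have point: "chart_inv c (snd z) \<in> chart_dom c" "fst z \<in> time_interval T"
     "chart_map c (chart_inv c (snd z)) = snd z" if "z \<in> ?S" for z
    using that chart_inv_in[OF chart[OF c]] chart_map_inv[OF chart[OF c]] by auto
  have Fpos: "0 < in_chart c f z" if "z \<in> ?S" for z
    unfolding in_chart_def using f_pos_point[OF c] point[OF that] by blast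
  have G: "continuous_on ?S (\<lambda>z. in_chart c (\<lambda>t. g t c) z $ i $ j)" for i j
    by (intro continuous_on_component smooth_on_continuous[OF smooth_g[OF c]])
  have B: "continuous_on ?S (\<lambda>z. matrix_inv (in_chart c (\<lambda>t. g t c) z) $ i $ j)" for i j
  proof (rule continuous_on_matrix_inv[OF G])
    fix z assume "z \<in> ?S"
    then show "invertible (in_chart c (\<lambda>t. g t c) z)"
      unfolding in_chart_def using point metric_pos_def c pos_def_invertible by blast
  qed
  have "continuous_on ?S (\<lambda>z. fst z * ((\<Sum>i\<in>UNIV. \<Sum>j\<in>UNIV. matrix_inv (in_chart c (\<lambda>t. g t c) z) $ i $ j * D i z * D j z)
      / (in_chart c f z)\<^sup>2) - (- ln (in_chart c f z)))"
    using Fpos by (intro continuous_intros B D F) fastforce+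
  moreover have "in_chart c W z = fst z * ((\<Sum>i\<in>UNIV. \<Sum>j\<in>UNIV. matrix_inv (in_chart c (\<lambda>t. g t c) z) $ i $ j * D i z * D j z)
      / (in_chart c f z)\<^sup>2) - (- ln (in_chart c f z))" if z: "z \<in> ?S" for z
  proof -
    note pz = point[OF z]
    have "pderiv_chart c i (f (fst z)) (chart_inv c (snd z)) = D i z" for i
      unfolding D_def using f_slice(2)[OF c pz(1,2), of i] by (simp only: pz(3) prod.collapse)
    then have "grad_norm_sq (g (fst z)) c (f (fst z)) (chart_inv c (snd z))
        = (\<Sum>i\<in>UNIV. \<Sum>j\<in>UNIV. matrix_inv (in_chart c (\<lambda>t. g t c) z) $ i $ j * D i z * D j z)"
      by (simp add: grad_norm_sq_def metric_inv_def in_chart_def)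
    then show ?thesis
      unfolding in_chart_def[of c W] W_chart[OF c pz(1,2)] grad_norm_sq_u[OF c pz(1,2)]
      by (simp add: in_chart_def u_def)
  qed
  ultimately show ?thesis
    by (subst continuous_on_cong[OF refl]) auto
qed

text \<open>The global argument: a maximum of $W - \varepsilon t$ over $[0,t_0]\times M$ lies at a positive
  time, where the local maximum principle makes $W - \varepsilon t$ strictly decreasing in time; just
  before that time it would be larger.\<close>
lemma W_nonpos:
  assumes t0: "0 < t0" "ereal t0 < T" and p0: "p0 \<in> topspace M"
  shows "W t0 p0 \<le> 0"
proof (rule ccontr)
  assume "\<not> W t0 p0 \<le> 0"
  then have W0: "0 < W t0 p0" by simp
  (* With this choice W - \<epsilon> t still has half of its value at the point (t0, p0). *)
  define \<epsilon> where "\<epsilon> = W t0 p0 / (2 * t0)"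
  have \<epsilon>: "0 < \<epsilon>" and \<epsilon>0: "W t0 p0 - \<epsilon> * t0 > 0"
    using W0 t0 by (simp_all add: \<epsilon>_def)
  define F where "F = (\<lambda>(t, p). W t p - \<epsilon> * t)"
  define X where "X = prod_topology (top_of_set {0..t0}) M"
  have sub: "{0..t0} \<subseteq> time_interval T"
  proof
    fix t assume "t \<in> {0..t0}"
    then have "0 \<le> t" "ereal t \<le> ereal t0" by auto
    then show "t \<in> time_interval T"
      using le_less_trans[OF _ t0(2)] unfolding time_interval_def by blast
  qed
  have X: "topspace X = {0..t0} \<times> topspace M"
    by (simp add: X_def)
  have cover: "\<exists>c\<in>A. p \<in> chart_dom c" if "p \<in> topspace M" for p
    using atlas that unfolding smooth_atlas_def by blast
  have cont: "continuous_map X euclideanreal F"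
  proof (rule pasting_lemma[where I = A and T = "\<lambda>c. {0..t0} \<times> chart_dom c" and f = "\<lambda>_. F"])
    fix c assume c: "c \<in> A"
    note ch = chart[OF c]
    show "openin X ({0..t0} \<times> chart_dom c)"
      using ch unfolding X_def is_chart_def by (simp add: openin_prod_Times_iff)
    have sX: "subtopology X ({0..t0} \<times> chart_dom c)
        = prod_topology (top_of_set {0..t0}) (subtopology M (chart_dom c))"
      by (simp add: X_def subtopology_Times subtopology_subtopology)
    have "continuous_map (subtopology M (chart_dom c)) (top_of_set (chart_image c)) (chart_map c)"
      using ch homeomorphic_imp_continuous_map unfolding is_chart_def by blast
    then have 1: "continuous_map (subtopology X ({0..t0} \<times> chart_dom c)) (top_of_set ({0..t0} \<times> chart_image c))
        (\<lambda>(t, p). (t, chart_map c p))"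
      unfolding sX prod_topology_subtopology_eu[symmetric] continuous_map_prod_top by simp
    have "continuous_on ({0..t0} \<times> chart_image c) (\<lambda>z. in_chart c W z - \<epsilon> * fst z)"
      using sub by (intro continuous_intros continuous_on_subset[OF continuous_W_in_chart[OF c]]) auto
    then have 2: "continuous_map (top_of_set ({0..t0} \<times> chart_image c)) euclideanreal
        (\<lambda>z. in_chart c W z - \<epsilon> * fst z)"
      by simp
    show "continuous_map (subtopology X ({0..t0} \<times> chart_dom c)) euclideanreal F"
    proof (rule continuous_map_eq[OF continuous_map_compose[OF 1 2]])
      fix y assume "y \<in> topspace (subtopology X ({0..t0} \<times> chart_dom c))"
      then show "((\<lambda>z. in_chart c W z - \<epsilon> * fst z) \<circ> (\<lambda>(t, p). (t, chart_map c p))) y = F y"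
        using chart_inv_map[OF ch] by (auto simp: X F_def in_chart_def)
    qed
  next
    fix y assume "y \<in> topspace X"
    then show "\<exists>c. c \<in> A \<and> y \<in> {0..t0} \<times> chart_dom c \<and> F y = F y"
      using cover[of "snd y"] unfolding X mem_Times_iff by blast
  qed auto
  have "compact_space X"
    unfolding X_def compact_space_prod_topology
    using compact by (simp add: compact_space_subtopology)
  then have "compact (F ` topspace X)"
    using image_compactin[OF _ cont] unfolding compact_space_def by simp
  moreover have m0: "(t0, p0) \<in> topspace X"
    using t0 p0 by (simp add: X)
  ultimately have "\<exists>v\<in>F ` topspace X. \<forall>w\<in>F ` topspace X. w \<le> v"
    by (intro compact_attains_sup) auto
  then obtain y where y: "y \<in> topspace X" "\<forall>x\<in>topspace X. F x \<le> F y"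
    by blast
  obtain t1 p1 where "y = (t1, p1)" by (cases y)
  with y have m: "(t1, p1) \<in> topspace X" and max: "\<And>x. x \<in> topspace X \<Longrightarrow> F x \<le> F (t1, p1)"
    by simp_all
  have t1: "0 \<le> t1" "t1 \<le> t0" and p1: "p1 \<in> topspace M"
    using m by (auto simp: X)
  obtain c where c: "c \<in> A" and pc: "p1 \<in> chart_dom c"
    using cover[OF p1] by blast
  have "0 < F (t1, p1)"
    using max[OF m0] \<epsilon>0 by (simp add: F_def)
  moreover have "F (0, p1) < 0"
  proof -
    have "0 \<in> time_interval T" using sub t0 by auto
    from f_range[OF this p1] have "ln (f 0 p1) < 0" by simp
    then show ?thesis by (simp add: F_def W_def u_def)
  qed
  ultimately have t1_pos: "0 < t1"
    using t1 by (cases "t1 = 0") auto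
  define z where "z = (t1, chart_map c p1)"
  have "ereal t1 < T"
    using t1(2) by (intro le_less_trans[OF _ t0(2)]) simp
  then have z: "z \<in> spacetime c"
    using t1_pos chart_map_in[OF chart[OF c] pc] by (simp add: z_def spacetime_def open_times_def)
  interpret L: local_ricci_flow "spacetime c" "G c" "B c"
    by (rule local_ricci_flow_chart[OF c])
  define w where "w = (\<lambda>z. fst z * L.grad_sq (in_chart c u) z - in_chart c u z)"
  have w: "in_chart c W y = w y" if y: "y \<in> spacetime c" for y
    unfolding in_chart_def[of c W] W_chart[OF c spacetimeD(3,2)[OF c y]]
      grad_norm_sq_chart[OF c smooth_u_in_chart[OF c] refl y] w_def
    by (simp add: in_chart_def)
  have dt_w: "dt w z \<le> 0"
    unfolding w_def
  proof (rule L.dt_nonpos_at_spatial_max[OF smooth_u_in_chart[OF c] z _ dt_u[OF c]])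
    show "0 \<le> fst z" using t1 by (simp add: z_def)
    fix y assume y: "y \<in> spacetime c" "fst y = fst z"
    have "F (t1, chart_inv c (snd y)) \<le> F (t1, p1)"
      using spacetimeD[OF c y(1)] chart_dom_subset[OF chart[OF c]] t1 by (intro max) (auto simp: X)
    then have "in_chart c W y \<le> in_chart c W z"
      using y chart_inv_map[OF chart[OF c] pc] by (simp add: F_def in_chart_def z_def)
    then show "fst y * L.grad_sq (in_chart c u) y - in_chart c u y \<le> fst z * L.grad_sq (in_chart c u) z - in_chart c u z"
      using w[OF y(1)] w[OF z] by (simp add: w_def)
  qed
  have "smooth_on (spacetime c) w"
    unfolding w_def
    by (intro smooth_on_diff smooth_on_mult spacetime_open[OF c] L.smooth_grad_sq smooth_u_in_chart[OF c]
        smooth_on_bounded_linear bounded_linear_fst)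
  moreover have zline: "(0, chart_map c p1) + t1 *\<^sub>R (1, 0) = z"
    by (simp add: z_def)
  ultimately have "((\<lambda>s. w ((0, chart_map c p1) + s *\<^sub>R (1, 0))) has_real_derivative dt w z) (at t1)"
    using line_derivative[OF spacetime_open[OF c], of w "(0, chart_map c p1)" t1 "(1, 0)"] z by metis
  then have "((\<lambda>s. w (s, chart_map c p1) - \<epsilon> * s) has_real_derivative dt w z - \<epsilon>) (at t1)"
    by (auto intro!: derivative_eq_intros)
  from has_real_derivative_neg_dec_left[OF this] dt_w \<epsilon> obtain d where d: "d > 0"
    and dec: "\<And>h. h > 0 \<Longrightarrow> h < d \<Longrightarrow>
      w (t1, chart_map c p1) - \<epsilon> * t1 < w (t1 - h, chart_map c p1) - \<epsilon> * (t1 - h)"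
    by auto
  define h where "h = min d t1 / 2"
  have h: "0 < h" "h < d" "h < t1"
    using d t1_pos by (auto simp: h_def)
  have "ereal (t1 - h) < T"
    using h(1) by (intro le_less_trans[OF _ \<open>ereal t1 < T\<close>]) simp
  then have y: "(t1 - h, chart_map c p1) \<in> spacetime c"
    using h chart_map_in[OF chart[OF c] pc] by (simp add: spacetime_def open_times_def)
  have "F (t1 - h, p1) \<le> F (t1, p1)"
    using h t1 p1 by (intro max) (simp add: X)
  moreover have "F (t1 - h, p1) = w (t1 - h, chart_map c p1) - \<epsilon> * (t1 - h)"
    using w[OF y] chart_inv_map[OF chart[OF c] pc] by (simp add: F_def in_chart_def)
  moreover have "F (t1, p1) = w (t1, chart_map c p1) - \<epsilon> * t1"
    using w[OF z] chart_inv_map[OF chart[OF c] pc] by (simp add: F_def in_chart_def z_def)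
  ultimately show False
    using dec[OF h(1,2)] by simp
qed

lemma gradient_estimate:
  assumes c: "c \<in> A" and p: "p \<in> chart_dom c" and t: "0 < t" "ereal t < T"
  shows "(metric_norm (g t) c p (gradient (g t) c (u t) p))\<^sup>2 - u t p / t \<le> 0"
    and "(metric_norm (g t) c p (gradient (g t) c (f t) p))\<^sup>2 \<le> - ((f t p)\<^sup>2 * ln (f t p) / t)"
proof -
  have tI: "t \<in> time_interval T" using t by (simp add: time_interval_def)
  have pM: "p \<in> topspace M" using p chart_dom_subset[OF chart[OF c]] by blast
  note pd = metric_pos_def[OF tI c p]
  have "t * grad_norm_sq (g t) c (u t) p \<le> u t p"
    using W_nonpos[OF t pM] unfolding W_chart[OF c p tI] by simp
  then have le: "grad_norm_sq (g t) c (u t) p \<le> u t p / t"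
    using t by (simp add: field_simps)
  then show "(metric_norm (g t) c p (gradient (g t) c (u t) p))\<^sup>2 - u t p / t \<le> 0"
    unfolding metric_norm_gradient_sq[where \<gamma> = "g t", OF pd] by simp
  have "grad_norm_sq (g t) c (f t) p = (f t p)\<^sup>2 * grad_norm_sq (g t) c (u t) p"
    unfolding grad_norm_sq_u[OF c p tI] using f_pos_point[OF c p tI] by simp
  also have "\<dots> \<le> (f t p)\<^sup>2 * (u t p / t)"
    by (rule mult_left_mono[OF le]) simp
  finally show "(metric_norm (g t) c p (gradient (g t) c (f t) p))\<^sup>2 \<le> - ((f t p)\<^sup>2 * ln (f t p) / t)"
    unfolding metric_norm_gradient_sq[where \<gamma> = "g t", OF pd] by (simp add: u_def)
qed

end

theorem theorem5p1:
  fixes M :: "'m topology"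
    and A :: "('m, 'n::finite) chart set"
    and T :: ereal
    and g :: "real \<Rightarrow> ('m, 'n) metric_field"
    and f :: "real \<Rightarrow> 'm \<Rightarrow> real"
    and u :: "real \<Rightarrow> 'm \<Rightarrow> real"
    and H :: "('m, 'n) chart \<Rightarrow> real \<Rightarrow> 'm \<Rightarrow> real"
  assumes "closed_manifold M A"
    and "0 < T"
    and "ricci_flow A T g"
    and "heat_solution A T g f"
    and "\<And>t p. t \<in> time_interval T \<Longrightarrow> p \<in> topspace M \<Longrightarrow> 0 < f t p \<and> f t p < 1"
    and "\<And>t p. u t p = - ln (f t p)"
    and "\<And>c t p. H c t p = (metric_norm (g t) c p (gradient (g t) c (u t) p))\<^sup>2 - u t p / t"
  shows "(\<forall>c\<in>A. \<forall>p\<in>chart_dom c. \<forall>t. 0 < t \<and> ereal t < T \<longrightarrow> H c t p \<le> 0) \<and>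
         (\<forall>c\<in>A. \<forall>p\<in>chart_dom c. \<forall>t. 0 < t \<and> ereal t < T \<longrightarrow>
            (metric_norm (g t) c p (gradient (g t) c (f t) p))\<^sup>2
              \<le> - ((f t p)\<^sup>2 * ln (f t p) / t))"
proof -
  interpret ricci_heat_flow M A T g f
    using assms(1,3,4,5) by unfold_locales auto
  have "u t = ricci_heat_flow.u f t" for t
    using assms(6) by (simp add: u_def fun_eq_iff)
  then show ?thesis
    using gradient_estimate unfolding assms(7) by simp
qed

end
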